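(* Let $(C_n)_{n\in\mathbb{N}}$ be a family of XOR-circuits, $C_n$ over the $n$-dimensional hypercube $\mathcal{H}_n$, such that: (1) there is a polynomial $p$ with $|V_{C_n}|\le p(2^n)$ for all $n$; (2) every $\pi\in\mathrm{Sym}_n$ extends to an automorphism of $C_n$; (3) there is $f(n)\in O(n)$ such that for all sufficiently large $n$, for every gate $g$ of $C_n$ and every parent $h$ of $g$, $|\mathrm{Orbit}_{(g)}(h)|\le f(n)$ and $|\mathrm{Orbit}_{(h)}(g)|\le f(n)$. Let $\varepsilon>0$ be a constant and let, for every $n$, $g_n$ be a gate of $C_n$ such that $\mathrm{SP}_A(g_n)$ contains at least two parts of size $\ge \varepsilon n$. Then for all sufficiently large $n$, the number of distinct directed paths from the root of $C_n$ to $g_n$ is even.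
   Context: $\mathcal{H}_n$ has vertex set $\{0,1\}^n$, $u,v$ adjacent iff they differ in exactly one position; $\mathrm{Sym}_n$ acts on $\{0,1\}^n$ by $\pi(v_1\dots v_n)=v_{\pi^{-1}(1)}\dots v_{\pi^{-1}(n)}$ and hence on edges. An XOR-circuit over $\mathcal{H}_n$ is a finite connected DAG $C=(V_C,E_C)$ with a unique designated root; a wire $(g,h)\in E_C$ means $h$ is a child of $g$ ($g$ a parent of $h$); paths go from parents to children. Leaves are input gates, injectively labelled by $\ell$ with edges of $\mathcal{H}_n$; internal gates compute the XOR of their children. $\mathrm{Aut}(C_n)$ is the set of automorphisms $\sigma$ of the rooted DAG for which there is $\pi\in\mathrm{Sym}_n$ with $\ell(\sigma(g))=\pi(\ell(g))$ for all input gates $g$ ($\pi$ extends to $\sigma$). $\mathrm{Orbit}_{(g)}(h):=\{\sigma(h)\mid \sigma\in\mathrm{Aut}(C_n),\sigma(g)=g\}$, $\mathrm{Orbit}_{(h)}(g):=\{\sigma(g)\mid\sigma\in\mathrm{Aut}(C_n),\sigma(h)=h\}$. For a gate $g$, $\mathrm{Stab}_n(g)\le\mathrm{Sym}_n$ is the group of $\pi\in\mathrm{Sym}_n$ that extend to some $\sigma\in\mathrm{Aut}(C_n)$ with $\sigma(g)=g$. For a finite set $A$ and $G\le\mathrm{Sym}(A)$, an alternating supporting partition of $G$ is a partition $\mathcal{P}$ of $A$ such that $\prod_{P\in\mathcal{P},|P|<5}\mathrm{Sym}(P)\times\prod_{P\in\mathcal{P},|P|\ge5}\mathrm{Alt}(P)\le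 G$ (each factor acting on its part and fixing all other points). Every such $G$ has a unique coarsest alternating supporting partition (every alternating supporting partition of $G$ refines it), denoted $\mathrm{SP}_A(G)$; $\mathrm{SP}_A(g):=\mathrm{SP}_A(\mathrm{Stab}_n(g))$, a partition of $[n]$. *)

theory Defs
  imports
    "HOL-Combinatorics.Permutations"
    "HOL-Computational_Algebra.Polynomial"
    "HOL-Library.Disjoint_Sets"
    "HOL-Library.FuncSet"
    "HOL-Library.Landau_Symbols"
begin

section \<open>The hypercube and the action of the symmetric group\<close>

definition cube_verts :: "nat \<Rightarrow> (nat \<Rightarrow> nat) set" where
  "cube_verts n = {1..n} \<rightarrow>\<^sub>E {0, 1}"

definition cube_edges :: "nat \<Rightarrow> (nat \<Rightarrow> nat) set set" where
  "cube_edges n =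
     {{u, v} | u v. u \<in> cube_verts n \<and> v \<in> cube_verts n \<and> card {i \<in> {1..n}. u i \<noteq> v i} = 1}"

text \<open>A permutation of \<open>{1..n}\<close> is the identity outside \<open>{1..n}\<close>, so that \<open>v \<circ> inv \<pi>\<close> is again an
  element of \<open>cube_verts n\<close>.\<close>

definition act_vert :: "(nat \<Rightarrow> nat) \<Rightarrow> (nat \<Rightarrow> nat) \<Rightarrow> (nat \<Rightarrow> nat)" where
  "act_vert \<pi> v = v \<circ> inv \<pi>"

definition act_edge :: "(nat \<Rightarrow> nat) \<Rightarrow> (nat \<Rightarrow> nat) set \<Rightarrow> (nat \<Rightarrow> nat) set" where
  "act_edge \<pi> e = act_vert \<pi> ` e"

section \<open>XOR-circuits\<close>

text \<open>A wire \<open>(g, h)\<close> leads from the parent \<open>g\<close> to the child \<open>h\<close>. All internal gates are XOR-gates,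
  so no gate type is recorded; the value of \<open>input_label\<close> on internal gates is irrelevant.\<close>

record 'g circuit =
  gates :: "'g set"
  wires :: "('g \<times> 'g) set"
  circuit_root :: 'g
  input_label :: "'g \<Rightarrow> (nat \<Rightarrow> nat) set"

definition input_gates :: "'g circuit \<Rightarrow> 'g set" where
  "input_gates C = {g \<in> gates C. \<forall>h. (g, h) \<notin> wires C}"

definition xor_circuit :: "nat \<Rightarrow> 'g circuit \<Rightarrow> bool" where
  "xor_circuit n C \<longleftrightarrow>
     finite (gates C) \<and>
     wires C \<subseteq> gates C \<times> gates C \<and>
     acyclic (wires C) \<and>
     (\<forall>g \<in> gates C. \<forall>h \<in> gates C. (g, h) \<in> (wires C \<union> (wires C)\<inverse>)\<^sup>*) \<and>
     circuit_root C \<in> gates C \<and>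
     input_label C ` input_gates C \<subseteq> cube_edges n \<and>
     inj_on (input_label C) (input_gates C)"

definition directed_paths :: "'g circuit \<Rightarrow> 'g \<Rightarrow> 'g \<Rightarrow> 'g list set" where
  "directed_paths C g h =
     {p. p \<noteq> [] \<and> set p \<subseteq> gates C \<and> hd p = g \<and> last p = h \<and>
         successively (\<lambda>x y. (x, y) \<in> wires C) p}"

section \<open>Automorphisms, orbits and stabilisers\<close>

definition rooted_dag_automorphism :: "'g circuit \<Rightarrow> ('g \<Rightarrow> 'g) \<Rightarrow> bool" where
  "rooted_dag_automorphism C \<sigma> \<longleftrightarrow>
     \<sigma> permutes gates C \<and>
     (\<forall>g \<in> gates C. \<forall>h \<in> gates C. (\<sigma> g, \<sigma> h) \<in> wires C \<longleftrightarrow> (g, h) \<in> wires C) \<and>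
     \<sigma> (circuit_root C) = circuit_root C"

definition extends_to :: "'g circuit \<Rightarrow> (nat \<Rightarrow> nat) \<Rightarrow> ('g \<Rightarrow> 'g) \<Rightarrow> bool" where
  "extends_to C \<pi> \<sigma> \<longleftrightarrow>
     rooted_dag_automorphism C \<sigma> \<and>
     (\<forall>g \<in> input_gates C. input_label C (\<sigma> g) = act_edge \<pi> (input_label C g))"

definition Aut :: "nat \<Rightarrow> 'g circuit \<Rightarrow> ('g \<Rightarrow> 'g) set" where
  "Aut n C = {\<sigma>. \<exists>\<pi>. \<pi> permutes {1..n} \<and> extends_to C \<pi> \<sigma>}"

text \<open>\<open>Orbit n C g h\<close> is the orbit of \<open>h\<close> under the automorphisms that fix \<open>g\<close>.\<close>

definition Orbit :: "nat \<Rightarrow> 'g circuit \<Rightarrow> 'g \<Rightarrow> 'g \<Rightarrow> 'g set" where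
  "Orbit n C g h = {\<sigma> h | \<sigma>. \<sigma> \<in> Aut n C \<and> \<sigma> g = g}"

definition Stab :: "nat \<Rightarrow> 'g circuit \<Rightarrow> 'g \<Rightarrow> (nat \<Rightarrow> nat) set" where
  "Stab n C g = {\<pi>. \<pi> permutes {1..n} \<and> (\<exists>\<sigma> \<in> Aut n C. extends_to C \<pi> \<sigma> \<and> \<sigma> g = g)}"

section \<open>Alternating supporting partitions\<close>

definition part_group :: "'a set \<Rightarrow> ('a \<Rightarrow> 'a) set" where
  "part_group P =
     (if card P < 5 then {\<sigma>. \<sigma> permutes P} else {\<sigma>. \<sigma> permutes P \<and> evenperm \<sigma>})"

text \<open>The internal direct product of the groups \<open>part_group P\<close> for \<open>P \<in> \<P>\<close>: for a partition \<open>\<P>\<close> of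
  \<open>A\<close>, it consists of the permutations of \<open>A\<close> whose restriction to each part is in the factor
  belonging to that part.\<close>

definition partition_group :: "'a set \<Rightarrow> 'a set set \<Rightarrow> ('a \<Rightarrow> 'a) set" where
  "partition_group A \<P> = {\<pi>. \<pi> permutes A \<and> (\<forall>P \<in> \<P>. restrict_id \<pi> P \<in> part_group P)}"

definition alternating_supporting_partition :: "'a set \<Rightarrow> ('a \<Rightarrow> 'a) set \<Rightarrow> 'a set set \<Rightarrow> bool" where
  "alternating_supporting_partition A G \<P> \<longleftrightarrow> partition_on A \<P> \<and> partition_group A \<P> \<subseteq> G"

definition coarsest_asp :: "'a set \<Rightarrow> ('a \<Rightarrow> 'a) set \<Rightarrow> 'a set set" where
  "coarsest_asp A G =
     (THE \<P>. alternating_supporting_partition A G \<P> \<and>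
             (\<forall>\<Q>. alternating_supporting_partition A G \<Q> \<longrightarrow> refines A \<Q> \<P>))"

definition SP :: "nat \<Rightarrow> 'g circuit \<Rightarrow> 'g \<Rightarrow> nat set set" where
  "SP n C g = coarsest_asp {1..n} (Stab n C g)"

end

theory Submission
  imports Defs "HOL-Combinatorics.Cycles"
begin

text \<open>
  Let \<open>k\<close> be a multiple of 4 of order \<open>\<epsilon> n\<close>, and call a gate \<open>g\<close> split if there are
  disjoint \<open>k\<close>-sets \<open>P\<close>, \<open>Q\<close> such that \<open>Stab g\<close> contains \<open>Alt(P)\<close> and \<open>Alt(Q)\<close> but not
  \<open>Alt(P \<union> Q)\<close>. A gate with two large parts is split and the root is not. We show by induction
  along the wires that a split gate is reached by an even number of paths.

  A subgroup of index \<open>O(k)\<close> in an alternating group of degree \<open>k\<close> contains, for large \<open>k\<close>, the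
  alternating group fixing some point. So if \<open>h\<close> is a parent of \<open>g\<close>, then \<open>Stab h\<close> contains
  \<open>Alt(P - {x})\<close> and \<open>Alt(Q - {y})\<close>. Choose an even involution \<open>\<tau>\<close> without fixed points on
  \<open>P \<union> Q\<close> that preserves \<open>P\<close> and \<open>Q\<close>, and lift it to an automorphism of 2-power order
  fixing \<open>g\<close>. Modulo 2, only the parents \<open>h\<close> fixed by this automorphism contribute to the number of
  paths to \<open>g\<close>. For these, conjugation by \<open>\<tau>\<close> shows \<open>Alt(P), Alt(Q) \<le> Stab h\<close>. If
  \<open>Alt(P \<union> Q) \<le> Stab h\<close>, the index bound in the other direction would give
  \<open>Alt(P \<union> Q) \<le> Stab g\<close>. Hence \<open>h\<close> is split as well.
\<close>

section \<open>Subgroups of small index in alternating groups\<close>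

definition alt :: "'a set \<Rightarrow> ('a \<Rightarrow> 'a) set" where
  "alt P = {\<sigma>. \<sigma> permutes P \<and> evenperm \<sigma>}"

lemma alt_mono: "P \<subseteq> Q \<Longrightarrow> alt P \<subseteq> alt Q"
  by (auto simp: alt_def intro: permutes_subset)

lemma transpose_comp_transpose_in_alt:
  assumes "a \<in> P" "b \<in> P" "c \<in> P" "d \<in> P" "a \<noteq> b" "c \<noteq> d"
  shows "transpose a b \<circ> transpose c d \<in> alt P"
  using assms
  by (simp add: alt_def permutes_compose permutes_swap_id evenperm_comp permutation_swap_id evenperm_swap)

lemma comp_transpose_comp_inv:
  assumes "bij \<mu>"
  shows "\<mu> \<circ> transpose a b \<circ> inv \<mu> = transpose (\<mu> a) (\<mu> b)"
proof -
  have "transpose (\<mu> a) (\<mu> b) \<circ> \<mu> = \<mu> \<circ> transpose a b"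
    using assms by (simp add: transpose_comp_eq bij_is_inj)
  then have "\<mu> \<circ> transpose a b \<circ> inv \<mu> = transpose (\<mu> a) (\<mu> b) \<circ> (\<mu> \<circ> inv \<mu>)"
    by (metis comp_assoc)
  moreover have "\<mu> \<circ> inv \<mu> = id"
    using assms surj_iff bij_is_surj by blast
  ultimately show ?thesis by simp
qed

section \<open>Three-cycles in a permutation group and the classes of points they link\<close>

locale perm_group =
  fixes A :: "'a set" and M :: "('a \<Rightarrow> 'a) set"
  assumes finite_carrier: "finite A"
    and permutes: "\<sigma> \<in> M \<Longrightarrow> \<sigma> permutes A"
    and id_mem: "id \<in> M"
    and comp_mem: "\<sigma> \<in> M \<Longrightarrow> \<rho> \<in> M \<Longrightarrow> \<sigma> \<circ> \<rho> \<in> M"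
    and inv_mem: "\<sigma> \<in> M \<Longrightarrow> inv \<sigma> \<in> M"
begin

text \<open>The composition is the 3-cycle taking a to b, b to c and c to a. Rotation and inversion
  of the cycle make the predicate invariant under every rearrangement of its arguments.\<close>

definition tri :: "'a \<Rightarrow> 'a \<Rightarrow> 'a \<Rightarrow> bool" where
  "tri a b c \<longleftrightarrow> a \<noteq> b \<and> b \<noteq> c \<and> a \<noteq> c \<and> transpose a b \<circ> transpose b c \<in> M"

text \<open>This turns out to be an equivalence relation, and \<open>M\<close> contains the
  alternating group of each finite set of pairwise linked points.\<close>

definition linked :: "'a \<Rightarrow> 'a \<Rightarrow> bool" where
  "linked a b \<longleftrightarrow> a = b \<or> (\<exists>c. tri a b c)"

lemma tri_rotate: "tri a b c \<Longrightarrow> tri b c a"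
proof -
  assume t: "tri a b c"
  then have "transpose b c \<circ> transpose c a = transpose a b \<circ> transpose b c"
    by (auto simp: tri_def fun_eq_iff transpose_def)
  with t show ?thesis by (auto simp: tri_def)
qed

lemma tri_flip: "tri a b c \<Longrightarrow> tri c b a"
proof -
  assume t: "tri a b c"
  then have "inv (transpose a b \<circ> transpose b c) \<in> M"
    by (auto simp: tri_def inv_mem)
  then have "transpose b c \<circ> transpose a b \<in> M"
    by (simp add: o_inv_distrib)
  with t show ?thesis
    by (auto simp: tri_def transpose_commute)
qed

lemma tri_swap: "tri a b c \<Longrightarrow> tri b a c"
  by (meson tri_flip tri_rotate)

lemma tri_conj: "\<mu> \<in> M \<Longrightarrow> tri a b c \<Longrightarrow> tri (\<mu> a) (\<mu> b) (\<mu> c)"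
proof -
  assume \<mu>: "\<mu> \<in> M" and t: "tri a b c"
  have bij: "bij \<mu>" using \<mu> permutes permutes_bij by blast
  have "(\<mu> \<circ> transpose a b \<circ> inv \<mu>) \<circ> (\<mu> \<circ> transpose b c \<circ> inv \<mu>)
      = \<mu> \<circ> (transpose a b \<circ> transpose b c) \<circ> inv \<mu>"
    using bij by (auto simp: fun_eq_iff bij_is_inj)
  also have "\<dots> \<in> M"
    using \<mu> t by (auto simp: tri_def intro!: comp_mem inv_mem)
  finally show ?thesis
    using t bij by (auto simp: tri_def comp_transpose_comp_inv bij_is_inj inj_eq)
qed

text \<open>Written with the common pair in the middle, the 3-cycles (p b y) and (y b q) each
  contain the transposition of b and y; in their product the two copies cancel.\<close>

lemma tri_share_edge:
  assumes "tri p b y" "tri q b y" "p \<noteq> q"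
  shows "tri p b q"
proof -
  have "tri y b q" using assms(2) tri_flip by blast
  then have "(transpose p b \<circ> transpose b y) \<circ> (transpose y b \<circ> transpose b q) \<in> M"
    using assms(1) by (auto simp: tri_def intro: comp_mem)
  also have "(transpose p b \<circ> transpose b y) \<circ> (transpose y b \<circ> transpose b q)
      = transpose p b \<circ> transpose b q"
    by (simp add: transpose_commute comp_assoc flip: comp_assoc[of "transpose b y" "transpose b y"])
  finally have "transpose p b \<circ> transpose b q \<in> M" .
  then show ?thesis
    using assms by (auto simp: tri_def)
qed

text \<open>Transitivity in a strong form: the 3-cycle on the three points themselves is obtained.
  It comes from two 3-cycles sharing a pair, and conjugation produces such cycles when none are
  given.\<close>

lemma tri_if_linked:
  assumes "linked a b" "linked b d" "a \<noteq> b" "b \<noteq> d" "a \<noteq> d"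
  shows "tri a b d"
proof -
  obtain c e where c: "tri a b c" and e: "tri b d e"
    using assms by (auto simp: linked_def)
  consider "c = d" | "e = a" | "c = e" "c \<noteq> d" "e \<noteq> a" | "c \<noteq> d" "e \<noteq> a" "c \<noteq> e" by blast
  then show ?thesis
  proof cases
    case 1 with c show ?thesis by simp
  next
    case 2 with e show ?thesis by (meson tri_rotate)
  next
    case 3
    with c e have "tri a b c" "tri d b c" by (auto intro: tri_swap)
    then show ?thesis using assms tri_share_edge by blast
  next
    case 4
    \<comment> \<open>The inverse of (a b c) sends b to a and fixes d and e, so it conjugates (b d
      e) to (a d e). These two cycles share the pair d, e.\<close>
    let ?\<mu> = "transpose a b \<circ> transpose b c"
    have "inv ?\<mu> \<in> M" using c by (auto simp: tri_def inv_mem)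
    then have "tri (inv ?\<mu> b) (inv ?\<mu> d) (inv ?\<mu> e)"
      using e tri_conj by blast
    moreover have "inv ?\<mu> = transpose b c \<circ> transpose a b"
      by (simp add: o_inv_distrib)
    ultimately have "tri a d e"
      using 4 c e assms by (auto simp: tri_def transpose_def)
    then have "tri a d e" "tri b d e" using e by auto
    then have "tri a d b" using assms tri_share_edge by blast
    then show ?thesis by (meson tri_rotate tri_flip)
  qed
qed

lemma linked_refl: "linked a a"
  by (simp add: linked_def)

lemma linked_sym: "linked a b \<Longrightarrow> linked b a"
  by (auto simp: linked_def dest: tri_swap)

lemma linked_trans: "linked a b \<Longrightarrow> linked b c \<Longrightarrow> linked a c"
  by (metis linked_def tri_if_linked tri_rotate tri_flip)

lemma linked_conj: "\<mu> \<in> M \<Longrightarrow> linked a b \<Longrightarrow> linked (\<mu> a) (\<mu> b)"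
  by (auto simp: linked_def dest: tri_conj)

text \<open>An even permutation is a product of pairs of transpositions. A pair with a common point
  is a 3-cycle or trivial, and (a b)(c d) is the product of (a b)(b c) and (b c)(c d).\<close>

lemma alt_subset_if_linked:
  assumes "finite R" and linked: "\<And>a b. a \<in> R \<Longrightarrow> b \<in> R \<Longrightarrow> linked a b"
  shows "alt R \<subseteq> M"
proof -
  have tri: "transpose a b \<circ> transpose b c \<in> M" if "a \<in> R" "b \<in> R" "c \<in> R" "a \<noteq> b" "b \<noteq> c" for a b c
  proof (cases "a = c")
    case True then show ?thesis by (simp add: transpose_commute id_mem)
  next
    case False
    with that show ?thesis using tri_if_linked[of a b c] linked by (auto simp: tri_def)
  qed
  have two: "transpose a b \<circ> transpose c d \<in> M"
    if "a \<in> R" "b \<in> R" "c \<in> R" "d \<in> R" "a \<noteq> b" "c \<noteq> d" for a b c d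
  proof (cases "b = c")
    case True with that tri show ?thesis by simp
  next
    case False
    have "(transpose a b \<circ> transpose b c) \<circ> (transpose b c \<circ> transpose c d) \<in> M"
      using that False by (intro comp_mem tri)
    also have "(transpose a b \<circ> transpose b c) \<circ> (transpose b c \<circ> transpose c d)
        = transpose a b \<circ> transpose c d"
      by (auto simp: fun_eq_iff)
    finally show ?thesis .
  qed
  \<comment> \<open>The induction adds one transposition at a time and so passes through odd
    permutations. For these the claim is that one more transposition leads into
    \<open>M\<close>.\<close>
  have "(evenperm \<sigma> \<longrightarrow> \<sigma> \<in> M) \<and>
      (\<not> evenperm \<sigma> \<longrightarrow> (\<forall>a\<in>R. \<forall>b\<in>R. a \<noteq> b \<longrightarrow> transpose a b \<circ> \<sigma> \<in> M))"
    if "\<sigma> permutes R" for \<sigma>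
    using that assms(1)
  proof (induction rule: permutes_induct)
    case id
    then show ?case using id_mem by (simp add: id_def)
  next
    case (swap a b p)
    have perm: "permutation p" using swap assms(1) permutation_permutes by blast
    have "evenperm (transpose a b \<circ> p) \<longleftrightarrow> \<not> evenperm p"
      using swap perm by (simp add: evenperm_comp permutation_swap_id evenperm_swap)
    moreover have "transpose c d \<circ> (transpose a b \<circ> p) \<in> M"
      if "evenperm p" "c \<in> R" "d \<in> R" "c \<noteq> d" for c d
      using comp_mem[OF two[of c d a b], of p] swap that by (simp add: comp_assoc)
    ultimately show ?case
      using swap by (auto simp: comp_def)
  qed
  then show ?thesis by (auto simp: alt_def)
qed

text \<open>Converse of \<open>alt_subset_if_linked\<close>. A third point is required to complete
  two distinct points to a 3-cycle.\<close>

lemma linked_if_alt_subset: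
  assumes "alt R \<subseteq> M" "3 \<le> card R" "a \<in> R" "b \<in> R"
  shows "linked a b"
proof (cases "a = b")
  case True then show ?thesis by (simp add: linked_refl)
next
  case False
  have "\<not> R \<subseteq> {a, b}"
    using assms(2) card_mono[of "{a, b}" R] False by auto
  then obtain c where "c \<in> R" "c \<noteq> a" "c \<noteq> b" by auto
  then have "tri a b c"
    using assms False transpose_comp_transpose_in_alt[of a R b b c] by (auto simp: tri_def)
  then show ?thesis by (auto simp: linked_def)
qed

text \<open>Every point of the union is linked to a common point of the two sets. This gluing step
  recurs throughout.\<close>

lemma alt_Un_subset:
  assumes "finite P" "finite Q" "alt P \<subseteq> M" "alt Q \<subseteq> M" "3 \<le> card P" "3 \<le> card Q" "P \<inter> Q \<noteq> {}"
  shows "alt (P \<union> Q) \<subseteq> M"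
proof (rule alt_subset_if_linked)
  show "finite (P \<union> Q)" using assms by simp
  obtain p where p: "p \<in> P" "p \<in> Q" using assms by auto
  have "linked a p" if "a \<in> P \<union> Q" for a
    using that p assms linked_if_alt_subset[of P a p] linked_if_alt_subset[of Q a p] by auto
  then show "linked a b" if "a \<in> P \<union> Q" "b \<in> P \<union> Q" for a b
    using that linked_sym linked_trans by blast
qed

lemma alt_image_subset:
  assumes "finite P" "alt P \<subseteq> M" "3 \<le> card P" "\<mu> \<in> M"
  shows "alt (\<mu> ` P) \<subseteq> M"
  using assms by (intro alt_subset_if_linked) (auto intro: linked_conj linked_if_alt_subset)

text \<open>Both elements are involutions, so xyxy is their commutator. The transpositions (c d) and
  (f h) are disjoint from everything else and cancel, which leaves the commutator of (b a) and (b
  e), a 3-cycle.\<close>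

lemma tri_if_commutator:
  assumes "distinct [a, b, e, c, d, f, h]"
    and x: "transpose b a \<circ> transpose c d \<in> M"
    and y: "transpose b e \<circ> transpose f h \<in> M"
  shows "tri a b e"
proof -
  let ?x = "transpose b a \<circ> transpose c d" and ?y = "transpose b e \<circ> transpose f h"
  have "?x \<circ> ?y \<circ> ?x \<circ> ?y \<in> M"
    by (intro comp_mem[OF comp_mem[OF comp_mem]] x y)
  moreover have "?x \<circ> ?y \<circ> ?x \<circ> ?y = transpose e b \<circ> transpose b a"
  proof
    fix z
    consider "z = a" | "z = b" | "z = e" | "z = c" | "z = d" | "z = f" | "z = h"
      | "z \<notin> {a, b, e, c, d, f, h}" by blast
    then show "(?x \<circ> ?y \<circ> ?x \<circ> ?y) z = (transpose e b \<circ> transpose b a) z"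
      using assms(1) by cases (auto simp: transpose_def)
  qed
  ultimately have "tri e b a" using assms(1) by (auto simp: tri_def)
  then show ?thesis by (rule tri_flip)
qed

text \<open>The colouring \<open>col\<close> stands for left cosets of \<open>M\<close>, so few colours means small index. Colour
  the edges of the complete graph on \<open>Q\<close> by the cosets of their transpositions. Adjacent edges of
  one colour yield a 3-cycle in \<open>M\<close>, so the edges of one colour between different classes of
  \<open>linked\<close> form a matching. If all classes were small, there would be two adjacent such edges with
  large colour classes, and these contain far-away edges that make the commutator trick of
  \<open>tri_if_commutator\<close> applicable.\<close>

lemma large_linked_class:
  fixes col :: "('a \<Rightarrow> 'a) \<Rightarrow> 'b"
  assumes fin: "finite Q" and card: "4 \<le> card Q" "40 * card (col ` alt Q) < (card Q)\<^sup>2"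
    and col: "\<And>\<sigma> \<rho>. \<sigma> \<in> alt Q \<Longrightarrow> \<rho> \<in> alt Q \<Longrightarrow> col \<sigma> = col \<rho> \<Longrightarrow> inv \<sigma> \<circ> \<rho> \<in> M"
  shows "\<exists>q\<in>Q. card Q < 2 * card {b \<in> Q. linked q b}"
proof (rule ccontr)
  assume "\<not> ?thesis"
  then have small: "2 * card {b \<in> Q. linked q b} \<le> card Q" if "q \<in> Q" for q
    using that by force
  let ?k = "card Q" and ?N = "card (col ` alt Q)"
  obtain s t where st: "s \<in> Q" "t \<in> Q" "s \<noteq> t"
    using card(1) card_le_Suc0_iff_eq[OF fin] by fastforce
  \<comment> \<open>A single transposition is odd. The fixed factor (s t) turns it into an element
    of \<open>alt Q\<close> and cancels again in \<open>inv \<sigma> \<circ> \<rho>\<close>.\<close>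
  define ec where "ec = (\<lambda>(a, b). col (transpose s t \<circ> transpose a b))"
  define D where "D = Sigma Q (\<lambda>a. Q - {b \<in> Q. linked a b})"
  have finD: "finite D" using fin by (auto simp: D_def)
  have D: "a \<in> Q" "b \<in> Q" "\<not> linked a b" "a \<noteq> b" if "(a, b) \<in> D" for a b
    using that linked_refl by (auto simp: D_def)
  have ecN: "card (ec ` D) \<le> ?N"
  proof (rule card_mono)
    show "finite (col ` alt Q)"
      using finite_subset[OF _ finite_permutations[OF fin], of "alt Q"] by (auto simp: alt_def)
    show "ec ` D \<subseteq> col ` alt Q"
      using st by (auto simp: ec_def intro!: imageI transpose_comp_transpose_in_alt dest: D)
  qed
  have same: "transpose a b \<circ> transpose c d \<in> M"
    if "(a, b) \<in> D" "(c, d) \<in> D" "ec (a, b) = ec (c, d)" for a b c d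
  proof -
    have "inv (transpose s t \<circ> transpose a b) \<circ> (transpose s t \<circ> transpose c d) \<in> M"
      using that D[of a b] D[of c d] st by (intro col transpose_comp_transpose_in_alt) (auto simp: ec_def)
    also have "inv (transpose s t \<circ> transpose a b) \<circ> (transpose s t \<circ> transpose c d)
        = transpose a b \<circ> transpose c d"
      by (simp add: o_inv_distrib) (simp add: fun_eq_iff)
    finally show ?thesis .
  qed
  define F where "F = (\<lambda>\<gamma>. {e \<in> D. ec e = \<gamma>})"
  have finF: "finite (F \<gamma>)" for \<gamma> using finD by (auto simp: F_def)
  have injF: "inj_on fst (F \<gamma>)" "inj_on snd (F \<gamma>)" for \<gamma>
  proof -
    show "inj_on fst (F \<gamma>)"
    proof (rule inj_onI, clarsimp simp: F_def)
      fix c d d' assume *: "(c, d) \<in> D" "(c, d') \<in> D" "ec (c, d') = ec (c, d)"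
      show "d = d'"
      proof (rule ccontr)
        assume "d \<noteq> d'"
        then have "tri d c d'"
          using same[of c d c d'] * D[of c d] D[of c d'] by (auto simp: tri_def transpose_commute)
        then have "linked c d" using linked_def linked_sym by blast
        then show False using D * by blast
      qed
    qed
    show "inj_on snd (F \<gamma>)"
    proof (rule inj_onI, clarsimp simp: F_def)
      fix c d d' assume *: "(d, c) \<in> D" "(d', c) \<in> D" "ec (d', c) = ec (d, c)"
      show "d = d'"
      proof (rule ccontr)
        assume "d \<noteq> d'"
        then have "tri d c d'"
          using same[of d c d' c] * D[of d c] D[of d' c] by (auto simp: tri_def transpose_commute)
        then have "linked d c" using linked_def by blast
        then show False using D * by blast
      qed
    qed
  qed
  \<comment> \<open>Both projections are injective on a colour class, so each point of
    \<open>S\<close> spoils at most two ordered pairs: one as first and one as second entry.\<close>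
  have avoid: "\<exists>c d. (c, d) \<in> F \<gamma> \<and> c \<notin> S \<and> d \<notin> S" if "finite S" "2 * card S < card (F \<gamma>)" for S \<gamma>
  proof (rule ccontr)
    assume "\<not> ?thesis"
    then have "F \<gamma> \<subseteq> {e \<in> F \<gamma>. fst e \<in> S} \<union> {e \<in> F \<gamma>. snd e \<in> S}" by force
    then have "card (F \<gamma>) \<le> card ({e \<in> F \<gamma>. fst e \<in> S} \<union> {e \<in> F \<gamma>. snd e \<in> S})"
      using finF by (intro card_mono) auto
    also have "\<dots> \<le> card {e \<in> F \<gamma>. fst e \<in> S} + card {e \<in> F \<gamma>. snd e \<in> S}"
      by (rule card_Un_le)
    also have "card {e \<in> F \<gamma>. fst e \<in> S} \<le> card S"
      using \<open>finite S\<close> by (intro card_inj_on_le[where f = fst] inj_on_subset[OF injF(1)]) auto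
    also have "card {e \<in> F \<gamma>. snd e \<in> S} \<le> card S"
      using \<open>finite S\<close> by (intro card_inj_on_le[where f = snd] inj_on_subset[OF injF(2)]) auto
    finally show False using that by simp
  qed
  \<comment> \<open>The largest set to be avoided below has 5 points, so a colour class with more
    than 2 times 5 pairs suffices.\<close>
  define Bad where "Bad = {e \<in> D. card (F (ec e)) \<le> 10}"
  have "card Bad \<le> 10 * ?N"
  proof -
    let ?B = "{\<gamma> \<in> ec ` D. card (F \<gamma>) \<le> 10}"
    have "card Bad \<le> card (\<Union>\<gamma>\<in>?B. F \<gamma>)"
      using finF finD by (intro card_mono) (auto simp: Bad_def F_def)
    also have "\<dots> \<le> (\<Sum>\<gamma>\<in>?B. card (F \<gamma>))"
      using finD by (intro card_UN_le) auto
    also have "\<dots> \<le> (\<Sum>\<gamma>\<in>?B. 10)"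
      by (intro sum_mono) auto
    also have "\<dots> \<le> 10 * card (ec ` D)"
      using finD by (auto intro: card_mono)
    finally show ?thesis using ecN by linarith
  qed
  moreover have "?k * ?k \<le> 2 * card D"
  proof -
    have "2 * card D = (\<Sum>a\<in>Q. 2 * card (Q - {b \<in> Q. linked a b}))"
      unfolding D_def using fin by (simp add: card_SigmaI sum_distrib_left)
    also have "\<dots> \<ge> (\<Sum>a\<in>Q. ?k)"
    proof (rule sum_mono)
      fix a assume "a \<in> Q"
      then show "?k \<le> 2 * card (Q - {b \<in> Q. linked a b})"
        using fin small[of a] by (simp add: card_Diff_subset)
    qed
    finally show ?thesis by simp
  qed
  moreover have "card (D - Bad) = card D - card Bad"
    using finD by (intro card_Diff_subset) (auto simp: Bad_def)
  moreover have "4 * ?k \<le> ?k * ?k" using card(1) by simp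
  \<comment> \<open>With k the size of \<open>Q\<close>, \<open>D\<close> has at least k^2/2 pairs
    and \<open>Bad\<close> has fewer than k^2/4 by the factor 40. What remains exceeds k^2/4, hence
    exceeds k as k is at least 4, so two remaining pairs have the same first entry.\<close>
  ultimately have "?k < card (D - Bad)"
    using card(2) unfolding power2_eq_square by linarith
  moreover have "fst ` (D - Bad) \<subseteq> Q" by (auto dest: D)
  ultimately have "\<not> inj_on fst (D - Bad)"
    using card_inj_on_le[of fst "D - Bad" Q] fin by auto
  then obtain b a e where bae: "(b, a) \<in> D - Bad" "(b, e) \<in> D - Bad" "a \<noteq> e"
    unfolding inj_on_def by (metis prod.collapse)
  have ba: "b \<noteq> a" "b \<noteq> e" using bae D by blast+
  have "card (F (ec (b, a))) > 10" "card (F (ec (b, e))) > 10"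
    using bae by (auto simp: Bad_def)
  moreover have "card {a, b, e} \<le> 3" by (auto simp: card_insert_if)
  ultimately obtain c d where cd: "(c, d) \<in> F (ec (b, a))" "c \<notin> {a, b, e}" "d \<notin> {a, b, e}"
    using avoid[of "{a, b, e}" "ec (b, a)"] by fastforce
  have "card {a, b, e, c, d} \<le> 5" by (auto simp: card_insert_if)
  with \<open>card (F (ec (b, e))) > 10\<close>
  obtain f h where fh: "(f, h) \<in> F (ec (b, e))" "f \<notin> {a, b, e, c, d}" "h \<notin> {a, b, e, c, d}"
    using avoid[of "{a, b, e, c, d}" "ec (b, e)"] by fastforce
  have "c \<noteq> d" "f \<noteq> h" using cd fh D by (auto simp: F_def)
  then have "tri a b e"
    using ba bae cd fh
    by (intro tri_if_commutator[of a b e c d f h] same) (auto simp: F_def)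
  then have "linked b a" using linked_def linked_sym by blast
  then show False using bae D by blast
qed

text \<open>If two points \<open>a\<close>, \<open>b\<close> lay outside the large class \<open>R\<close>, the quadratically many permutations
  \<open>(a c)(b d)\<close> with \<open>c, d \<in> R\<close> would move \<open>R\<close> to different sets, hence lie in different cosets.\<close>

lemma alt_point_stabiliser_subset:
  fixes col :: "('a \<Rightarrow> 'a) \<Rightarrow> 'b"
  assumes fin: "finite Q" and card: "4 \<le> card Q" "40 * card (col ` alt Q) < (card Q)\<^sup>2"
    and col: "\<And>\<sigma> \<rho>. \<sigma> \<in> alt Q \<Longrightarrow> \<rho> \<in> alt Q \<Longrightarrow> col \<sigma> = col \<rho> \<Longrightarrow> inv \<sigma> \<circ> \<rho> \<in> M"
  shows "\<exists>x\<in>Q. alt (Q - {x}) \<subseteq> M"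
proof -
  obtain q where q: "q \<in> Q" "card Q < 2 * card {b \<in> Q. linked q b}"
    using large_linked_class[OF fin card col] by blast
  define R where "R = {b \<in> Q. linked q b}"
  have finR: "finite R" using fin by (simp add: R_def)
  have R_linked: "linked a b" if "a \<in> R" "b \<in> R" for a b
    using that linked_sym linked_trans unfolding R_def by blast
  have R_closed: "b \<in> R" if "a \<in> R" "b \<in> Q" "linked a b" for a b
    using that linked_trans unfolding R_def by blast
  have "alt R \<subseteq> M"
    using finR R_linked by (rule alt_subset_if_linked)
  moreover have "\<exists>x\<in>Q. Q - {x} \<subseteq> R"
  proof (rule ccontr)
    assume neg: "\<not> ?thesis"
    then obtain a where a: "a \<in> Q" "a \<notin> R" using q(1) by auto
    then obtain b where b: "b \<in> Q" "b \<notin> R" "b \<noteq> a" using neg by auto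
    \<comment> \<open>Taking c and d from disjoint halves ensures that they differ. The halves have
      at least |Q|/8 and |Q|/4 points, the 8 absorbing the rounding, so there are at least |Q|^2/32
      pairs, more than there are colours.\<close>
    obtain R1 where R1: "R1 \<subseteq> R" "card R1 = card R div 2"
      by (meson div_le_dividend obtain_subset_with_card_n)
    define R2 where "R2 = R - R1"
    have finR12: "finite R1" "finite R2" using finR R1 finite_subset by (auto simp: R2_def)
    have "card R2 = card R - card R div 2"
      using R1 finR12 by (simp add: R2_def card_Diff_subset)
    then have "card R \<le> 2 * card R2" "card R \<le> 2 * card R1 + 1" using R1(2) by linarith+
    then have "card Q < 4 * card R2" "card Q < 4 * card R1 + 2 \<or> card Q \<le> 4 * card R1"
      using q(2) by (auto simp: R_def[symmetric])
    then have r: "card Q \<le> 4 * card R2" "card Q \<le> 8 * card R1"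
      using card(1) by linarith+
    have "(card Q)\<^sup>2 \<le> (8 * card R1) * (4 * card R2)"
      unfolding power2_eq_square using r by (intro mult_mono) auto
    then have big: "card (col ` alt Q) < card (R1 \<times> R2)"
      using card(2) by (simp add: card_cartesian_product)
    define w where "w = (\<lambda>(c, d). transpose a c \<circ> transpose b d)"
    have w: "w e \<in> alt Q" if "e \<in> R1 \<times> R2" for e
      using that a b R1 by (auto simp: w_def R2_def R_def intro!: transpose_comp_transpose_in_alt)
    have "finite (col ` alt Q)"
      using finite_subset[OF _ finite_permutations[OF fin], of "alt Q"] by (auto simp: alt_def)
    then have "\<not> inj_on (col \<circ> w) (R1 \<times> R2)"
      using big card_inj_on_le[of "col \<circ> w" "R1 \<times> R2" "col ` alt Q"] w by fastforce
    then obtain e e' where ee: "e \<in> R1 \<times> R2" "e' \<in> R1 \<times> R2" "e \<noteq> e'" "col (w e) = col (w e')"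
      by (auto simp: inj_on_def)
    obtain c d c' d' where cd: "e = (c, d)" "e' = (c', d')" by (cases e, cases e')
    have mem: "c \<in> R" "d \<in> R" "c' \<in> R" "d' \<in> R" "c \<noteq> d" "c \<noteq> d'" "c' \<noteq> d" "c' \<noteq> d'"
      using ee cd R1 by (auto simp: R2_def)
    define \<mu> where "\<mu> = inv (w e) \<circ> w e'"
    have \<mu>: "\<mu> \<in> M" unfolding \<mu>_def using ee w by (intro col) auto
    have ne: "a \<noteq> c" "a \<noteq> d" "a \<noteq> c'" "a \<noteq> d'" "b \<noteq> c" "b \<noteq> d" "b \<noteq> c'" "b \<noteq> d'" "a \<noteq> b"
      using mem a b by blast+
    have "inj (w e)" by (auto simp: w_def cd intro: inj_compose)
    then have inv_w: "inv (w e) y = x" if "w e x = y" for x y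
      using that by auto
    have we: "w e a = c" "w e b = d" "w e c = a" "w e d = b"
      using ne mem by (auto simp: w_def cd transpose_def)
    have we': "w e' c' = a" "w e' d' = b" "c \<noteq> c' \<Longrightarrow> w e' c = c" "d \<noteq> d' \<Longrightarrow> w e' d = d"
      using ne mem by (auto simp: w_def cd transpose_def)
    \<comment> \<open>As an element of \<open>M\<close>, \<mu> preserves linkedness. If c and c'
      differ, it maps the linked points c', c to c, a and so links a to \<open>R\<close>; otherwise
      d and d' differ and b is linked to \<open>R\<close> in the same way.\<close>
    have "a \<in> R \<or> b \<in> R"
    proof (cases "c = c'")
      case False
      have "linked (\<mu> c') (\<mu> c)"
        using \<mu> mem R_linked linked_conj by blast
      moreover have "\<mu> c' = c" "\<mu> c = a"
        using False we we' by (simp_all add: \<mu>_def inv_w)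
      ultimately show ?thesis using mem a R_closed by auto
    next
      case True
      then have "d \<noteq> d'" using ee cd by auto
      have "linked (\<mu> d') (\<mu> d)"
        using \<mu> mem R_linked linked_conj by blast
      moreover have "\<mu> d' = d" "\<mu> d = b"
        using \<open>d \<noteq> d'\<close> we we' by (simp_all add: \<mu>_def inv_w)
      ultimately show ?thesis using mem b R_closed by auto
    qed
    then show False using a b by blast
  qed
  ultimately show ?thesis using alt_mono by blast
qed

end

section \<open>The coarsest alternating supporting partition\<close>

lemma part_group_permutes: "\<sigma> \<in> part_group P \<Longrightarrow> \<sigma> permutes P"
  by (auto simp: part_group_def split: if_splits)

lemma id_in_part_group: "id \<in> part_group P"
  by (auto simp: part_group_def)

lemma alt_subset_part_group: "alt P \<subseteq> part_group P"
  by (auto simp: alt_def part_group_def)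

lemma part_group_subset_partition_group:
  assumes "partition_on A \<Q>" "P \<in> \<Q>"
  shows "part_group P \<subseteq> partition_group A \<Q>"
proof
  fix \<sigma> assume \<sigma>: "\<sigma> \<in> part_group P"
  then have perm: "\<sigma> permutes P" by (rule part_group_permutes)
  have "restrict_id \<sigma> X \<in> part_group X" if "X \<in> \<Q>" for X
  proof (cases "X = P")
    case True
    then have "restrict_id \<sigma> X = \<sigma>"
      using perm by (auto simp: restrict_id_def fun_eq_iff permutes_not_in)
    then show ?thesis using True \<sigma> by simp
  next
    case False
    then have "X \<inter> P = {}"
      using that assms by (auto simp: partition_on_def disjoint_def)
    then have "\<sigma> x = x" if "x \<in> X" for x
      using perm that permutes_not_in[of \<sigma> P x] by blast
    then have "restrict_id \<sigma> X = id"
      by (auto simp: restrict_id_def)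
    then show ?thesis by (simp add: id_in_part_group)
  qed
  moreover have "\<sigma> permutes A"
    using perm assms by (auto simp: partition_on_def intro: permutes_subset)
  ultimately show "\<sigma> \<in> partition_group A \<Q>"
    by (auto simp: partition_group_def)
qed

section \<open>Gluing overlapping part groups; maximal support classes\<close>

context perm_group
begin

lemma part_group_subset_if_transpositions:
  assumes "finite P" and trans: "\<And>a b. a \<in> P \<Longrightarrow> b \<in> P \<Longrightarrow> transpose a b \<in> M"
  shows "part_group P \<subseteq> M"
proof
  fix \<sigma> assume "\<sigma> \<in> part_group P"
  then have "\<sigma> permutes P" by (rule part_group_permutes)
  then show "\<sigma> \<in> M"
    using assms(1)
  proof (induction rule: permutes_induct)
    case id then show ?case using id_mem by (simp add: id_def)
  next
    case (swap a b p) then show ?case by (intro comp_mem trans)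
  qed
qed

text \<open>The new case is a set \<open>P\<close> too small to contain 3-cycles. Its part group is
  then the full symmetric group, and the transposition of a and p carries a link between p and a
  further point c of \<open>Q\<close> to a link between a and c.\<close>

lemma linked_if_part_groups:
  assumes fin: "finite P" "finite Q" and M: "part_group P \<subseteq> M" "part_group Q \<subseteq> M"
    and "p \<in> P" "p \<in> Q" "3 \<le> card Q" "a \<in> P"
  shows "linked a p"
proof (cases "3 \<le> card P \<or> a \<in> Q")
  case True
  have "alt P \<subseteq> M" "alt Q \<subseteq> M"
    using M alt_subset_part_group by blast+
  then show ?thesis
    using True assms linked_if_alt_subset by blast
next
  case False
  have "\<not> Q \<subseteq> {p}"
    using assms(7) card_mono[of "{p}" Q] by auto
  then obtain c where c: "c \<in> Q" "c \<noteq> p" by auto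
  have "transpose a p \<in> M"
    using False assms by (auto simp: part_group_def permutes_swap_id)
  moreover have pc: "linked p c"
    using assms c M(2) alt_subset_part_group linked_if_alt_subset by blast
  ultimately have "linked (transpose a p p) (transpose a p c)"
    by (rule linked_conj)
  moreover have "c \<noteq> a" using False c by auto
  ultimately have "linked a c" using c by simp
  then show ?thesis using pc linked_sym linked_trans by blast
qed

text \<open>The reason why a coarsest partition exists. If the union has fewer than 5 points, both
  groups are full symmetric groups and transpositions through p generate the rest. Otherwise one of
  the sets has at least 3 points, all points are linked, and the alternating group is exactly what
  is required.\<close>

lemma part_group_Un_subset:
  assumes fin: "finite P" "finite Q" and M: "part_group P \<subseteq> M" "part_group Q \<subseteq> M"
    and p: "p \<in> P" "p \<in> Q"
  shows "part_group (P \<union> Q) \<subseteq> M"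
proof (cases "card (P \<union> Q) < 5")
  case True
  then have "card P < 5" "card Q < 5"
    using fin card_mono[of "P \<union> Q" P] card_mono[of "P \<union> Q" Q] by auto
  then have tp: "transpose a p \<in> M" if "a \<in> P \<union> Q" for a
    using that M p by (auto simp: part_group_def permutes_swap_id)
  show ?thesis
  proof (rule part_group_subset_if_transpositions)
    fix a b assume ab: "a \<in> P \<union> Q" "b \<in> P \<union> Q"
    consider "a = b" | "a = p" | "b = p" | "a \<noteq> b" "p \<noteq> b" "a \<noteq> p" by blast
    then show "transpose a b \<in> M"
    proof cases
      case 1 then show ?thesis by (simp add: id_mem)
    next
      case 2 then show ?thesis using tp[of b] ab by (simp add: transpose_commute)
    next
      case 3 then show ?thesis using tp ab by simp
    next
      case 4
      have "transpose a p \<circ> transpose p b \<circ> transpose a p \<in> M"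
        using tp[of a] tp[of b] ab by (intro comp_mem) (auto simp: transpose_commute)
      then show ?thesis using 4 transpose_comp_triple[of a b p] by simp
    qed
  qed (use fin in simp)
next
  case False
  have P: "linked a p" if "3 \<le> card P" "a \<in> P \<union> Q" for a
    using that linked_if_part_groups[OF fin(1) fin(1) M(1) M(1) p(1) p(1), of a]
      linked_if_part_groups[OF fin(2) fin(1) M(2) M(1) p(2) p(1), of a] by blast
  have Q: "linked a p" if "3 \<le> card Q" "a \<in> P \<union> Q" for a
    using that linked_if_part_groups[OF fin(1) fin(2) M(1) M(2) p(1) p(2), of a]
      linked_if_part_groups[OF fin(2) fin(2) M(2) M(2) p(2) p(2), of a] by blast
  have "3 \<le> card P \<or> 3 \<le> card Q"
    using False card_Un_le[of P Q] by linarith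
  then have "linked a p" if "a \<in> P \<union> Q" for a
    using that P Q by blast
  then have "linked a b" if "a \<in> P \<union> Q" "b \<in> P \<union> Q" for a b
    using that linked_sym linked_trans by blast
  then have "alt (P \<union> Q) \<subseteq> M"
    using fin by (intro alt_subset_if_linked) auto
  then show ?thesis
    using False by (auto simp: part_group_def alt_def)
qed

text \<open>For a point \<open>i\<close> of \<open>A\<close>, this is the part of the coarsest
  alternating supporting partition that contains \<open>i\<close>. It is obtained as the largest
  admissible set around \<open>i\<close>.\<close>

definition support_class :: "'a \<Rightarrow> 'a set" where
  "support_class i = \<Union>{P. P \<subseteq> A \<and> i \<in> P \<and> part_group P \<subseteq> M}"

lemma support_class_upper: "P \<subseteq> A \<Longrightarrow> i \<in> P \<Longrightarrow> part_group P \<subseteq> M \<Longrightarrow> P \<subseteq> support_class i"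
  by (auto simp: support_class_def)

lemma support_class_subset: "support_class i \<subseteq> A"
  by (auto simp: support_class_def)

lemma part_group_singleton: "part_group {i} \<subseteq> M"
  by (intro part_group_subset_if_transpositions) (auto simp: id_mem)

lemma in_support_class: "i \<in> A \<Longrightarrow> i \<in> support_class i"
  using support_class_upper[of "{i}" i] part_group_singleton by auto

text \<open>The finitely many sets in the union all contain \<open>i\<close>, so
  \<open>part_group_Un_subset\<close> absorbs them one after the other.\<close>

lemma part_group_support_class:
  assumes "i \<in> A"
  shows "part_group (support_class i) \<subseteq> M"
proof -
  let ?F = "{P. P \<subseteq> A \<and> i \<in> P \<and> part_group P \<subseteq> M}"
  have "part_group (\<Union>F) \<subseteq> M" if "finite F" "F \<noteq> {}" "F \<subseteq> ?F" for F
    using that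
  proof (induction rule: finite_ne_induct)
    case (singleton P) then show ?case by simp
  next
    case (insert P F)
    have "P \<subseteq> A" "\<Union>F \<subseteq> A" using insert.prems by auto
    then have "finite P" "finite (\<Union>F)"
      using finite_carrier finite_subset by blast+
    moreover have "i \<in> P" "i \<in> \<Union>F" using insert.hyps insert.prems by auto
    ultimately show ?case
      using insert.IH insert.prems part_group_Un_subset[of P "\<Union>F" i] by simp
  qed
  moreover have "?F \<subseteq> Pow A" by auto
  then have "finite ?F" using finite_carrier finite_subset by blast
  moreover have "{i} \<in> ?F" using assms part_group_singleton by auto
  ultimately show ?thesis unfolding support_class_def by blast
qed

lemma support_class_eq:
  assumes "i \<in> A" "j \<in> A" "x \<in> support_class i" "x \<in> support_class j"
  shows "support_class i = support_class j"
proof -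
  let ?U = "support_class i \<union> support_class j"
  have fin: "finite (support_class k)" for k
    using support_class_subset finite_carrier finite_subset by blast
  have "part_group ?U \<subseteq> M"
    using assms fin part_group_support_class by (intro part_group_Un_subset) auto
  moreover have "?U \<subseteq> A" using support_class_subset by blast
  moreover have "i \<in> ?U" "j \<in> ?U" using assms in_support_class by auto
  ultimately have "?U \<subseteq> support_class i" "?U \<subseteq> support_class j"
    using support_class_upper by blast+
  then show ?thesis by blast
qed

lemma partition_on_support_classes: "partition_on A (support_class ` A)"
proof (rule partition_onI)
  show "\<Union> (support_class ` A) = A"
    using in_support_class support_class_subset by blast
  show "disjnt p q" if "p \<in> support_class ` A" "q \<in> support_class ` A" "p \<noteq> q" for p q
    using that support_class_eq unfolding disjnt_def by blast
  show "{} \<notin> support_class ` A"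
    using in_support_class by blast
qed

text \<open>A permutation preserving all parts is the product of its restrictions to them. The
  induction over the parts collects these finitely many factors.\<close>

lemma partition_group_subset:
  assumes part: "partition_on A \<P>" and M: "\<And>P. P \<in> \<P> \<Longrightarrow> part_group P \<subseteq> M"
  shows "partition_group A \<P> \<subseteq> M"
proof
  fix \<pi> assume \<pi>: "\<pi> \<in> partition_group A \<P>"
  have image: "\<pi> x \<in> P" if "P \<in> \<P>" "x \<in> P" for P x
  proof -
    have "restrict_id \<pi> P permutes P"
      using \<pi> that by (auto simp: partition_group_def intro: part_group_permutes)
    then have "restrict_id \<pi> P x \<in> P" using that permutes_in_image by metis
    then show ?thesis using that by simp
  qed
  have "restrict_id \<pi> (\<Union>F) \<in> M" if "finite F" "F \<subseteq> \<P>" for F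
    using that
  proof (induction rule: finite_induct)
    case empty
    have "restrict_id \<pi> (\<Union>{}) = id" by (auto simp: restrict_id_def)
    then show ?case using id_mem by metis
  next
    case (insert P F)
    have disj: "X \<inter> P = {}" if "X \<in> F" for X
      using that insert.hyps insert.prems partition_onD2[OF part]
      by (metis disjointD insert_subset subset_iff)
    have "restrict_id \<pi> P \<in> M"
      using \<pi> insert.prems M by (auto simp: partition_group_def)
    then have "restrict_id \<pi> P \<circ> restrict_id \<pi> (\<Union>F) \<in> M"
      using insert.IH insert.prems by (auto intro: comp_mem)
    moreover have "restrict_id \<pi> (\<Union>(insert P F)) = restrict_id \<pi> P \<circ> restrict_id \<pi> (\<Union>F)"
    proof
      fix x
      show "restrict_id \<pi> (\<Union>(insert P F)) x = (restrict_id \<pi> P \<circ> restrict_id \<pi> (\<Union>F)) x"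
      proof (cases "x \<in> \<Union>F")
        case True
        then obtain X where "X \<in> F" "x \<in> X" by blast
        then have "\<pi> x \<notin> P" using image[of X x] disj insert.prems by blast
        then show ?thesis using True by (auto simp: restrict_id_def)
      next
        case False then show ?thesis by (auto simp: restrict_id_def)
      qed
    qed
    ultimately show ?case by (simp only:)
  qed
  moreover have "finite \<P>"
    using finite_carrier part by (rule finite_elements)
  moreover have "restrict_id \<pi> (\<Union>\<P>) = \<pi>"
    using \<pi> part by (auto simp: partition_group_def partition_on_def restrict_id_def fun_eq_iff permutes_not_in)
  ultimately show "\<pi> \<in> M" by fastforce
qed

text \<open>This resolves the definite description. Each part of a supporting partition lies in the
  support class of any of its points, and antisymmetry of refinement gives uniqueness.\<close>

lemma coarsest_asp_eq: "coarsest_asp A M = support_class ` A"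
  unfolding coarsest_asp_def
proof (rule the_equality)
  have asp: "alternating_supporting_partition A M (support_class ` A)"
    unfolding alternating_supporting_partition_def
  proof
    show "partition_group A (support_class ` A) \<subseteq> M"
      using partition_on_support_classes part_group_support_class
      by (intro partition_group_subset) blast+
  qed (rule partition_on_support_classes)
  have refines: "refines A \<Q> (support_class ` A)" if "alternating_supporting_partition A M \<Q>" for \<Q>
    unfolding refines_def
  proof (intro conjI ballI)
    show part: "partition_on A \<Q>"
      using that by (simp add: alternating_supporting_partition_def)
    show "partition_on A (support_class ` A)" by (rule partition_on_support_classes)
    fix X assume X: "X \<in> \<Q>"
    then obtain x where "x \<in> X" "X \<subseteq> A"
      using part by (metis Union_upper ex_in_conv partition_onD1 partition_onD3)
    moreover have "part_group X \<subseteq> M"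
      using X that part_group_subset_partition_group[OF part X]
      by (auto simp: alternating_supporting_partition_def)
    ultimately show "\<exists>Y\<in>support_class ` A. X \<subseteq> Y"
      using support_class_upper by blast
  qed
  show "alternating_supporting_partition A M (support_class ` A) \<and>
    (\<forall>\<Q>. alternating_supporting_partition A M \<Q> \<longrightarrow> refines A \<Q> (support_class ` A))"
    using asp refines by blast
  show "\<P> = support_class ` A"
    if "alternating_supporting_partition A M \<P> \<and>
      (\<forall>\<Q>. alternating_supporting_partition A M \<Q> \<longrightarrow> refines A \<Q> \<P>)" for \<P>
    using that asp refines refines_asym by blast
qed

text \<open>The last claim is maximality of support classes: a union of at least 5 points has its
  alternating group as part group, so if that lay in \<open>M\<close>, the union would be contained
  in the class \<open>P\<close>.\<close>

lemma distinct_parts: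
  assumes "P \<in> coarsest_asp A M" "Q \<in> coarsest_asp A M" "P \<noteq> Q" "5 \<le> card P" "5 \<le> card Q"
  shows "P \<subseteq> A" "Q \<subseteq> A" "P \<inter> Q = {}" "alt P \<subseteq> M" "alt Q \<subseteq> M" "\<not> alt (P \<union> Q) \<subseteq> M"
proof -
  show sub: "P \<subseteq> A" "Q \<subseteq> A"
    using assms support_class_subset by (auto simp: coarsest_asp_eq)
  show disj: "P \<inter> Q = {}"
    using assms partition_on_support_classes unfolding coarsest_asp_eq partition_on_def disjoint_def
    by blast
  show "alt P \<subseteq> M" "alt Q \<subseteq> M"
    using assms part_group_support_class alt_subset_part_group by (auto simp: coarsest_asp_eq)
  show "\<not> alt (P \<union> Q) \<subseteq> M"
  proof
    assume "alt (P \<union> Q) \<subseteq> M"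
    moreover have "5 \<le> card (P \<union> Q)"
      using assms(4) card_mono[of "P \<union> Q" P] finite_subset[OF sub(1) finite_carrier]
        finite_subset[OF sub(2) finite_carrier] by simp
    ultimately have M: "part_group (P \<union> Q) \<subseteq> M"
      by (auto simp: part_group_def alt_def)
    obtain i where i: "i \<in> A" "P = support_class i" using assms(1) by (auto simp: coarsest_asp_eq)
    have "P \<union> Q \<subseteq> P"
      using support_class_upper[of "P \<union> Q" i] sub M i in_support_class by auto
    then have "Q = {}" using disj by blast
    then show False using assms(5) by simp
  qed
qed

end

section \<open>Parity of orbit sums\<close>

text \<open>The elements pair off into x and \<open>\<rho> x\<close> of equal weight.\<close>

lemma even_sum_fixpoint_free_involution:
  fixes w :: "'a \<Rightarrow> nat"
  assumes "finite S" "\<And>x. x \<in> S \<Longrightarrow> \<rho> x \<in> S \<and> \<rho> (\<rho> x) = x \<and> \<rho> x \<noteq> x \<and> w (\<rho> x) = w x"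
  shows "even (sum w S)"
  using assms
proof (induction rule: finite_psubset_induct)
  case (psubset S)
  show ?case
  proof (cases "S = {}")
    case False
    then obtain x where x: "x \<in> S" by auto
    define S' where "S' = S - {x, \<rho> x}"
    have \<rho>x: "\<rho> x \<in> S" "\<rho> x \<noteq> x" "w (\<rho> x) = w x" "\<rho> (\<rho> x) = x" using psubset.prems x by auto
    have "S = insert x (insert (\<rho> x) S')" using x \<rho>x by (auto simp: S'_def)
    moreover have "finite S'" "x \<notin> S'" "\<rho> x \<notin> S'" using psubset.hyps by (auto simp: S'_def)
    ultimately have "sum w S = 2 * w x + sum w S'"
      using \<rho>x by simp
    moreover have "even (sum w S')"
    proof (rule psubset.IH)
      show "S' \<subset> S" using x by (auto simp: S'_def)
      show "\<rho> y \<in> S' \<and> \<rho> (\<rho> y) = y \<and> \<rho> y \<noteq> y \<and> w (\<rho> y) = w y" if "y \<in> S'" for y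
        using that psubset.prems[of y] \<rho>x by (auto simp: S'_def)
    qed
    ultimately show ?thesis by simp
  qed simp
qed

text \<open>Orbit counting for a cyclic 2-group, by induction on the exponent. With exponent a + 1,
  the power 2^a of \<sigma> is an involution: the points it moves contribute an even sum, and on the
  points it fixes the exponent drops to a.\<close>

lemma even_sum_if_even_at_fixpoints:
  fixes w :: "'a \<Rightarrow> nat"
  assumes "finite S" and S: "\<And>x. x \<in> S \<Longrightarrow> \<sigma> x \<in> S \<and> w (\<sigma> x) = w x"
    and "\<And>x. x \<in> S \<Longrightarrow> (\<sigma> ^^ (2 ^ a)) x = x"
    and "\<And>x. x \<in> S \<Longrightarrow> \<sigma> x = x \<Longrightarrow> even (w x)"
  shows "even (sum w S)"
  using assms
proof (induction a arbitrary: S)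
  case 0
  then show ?case by (auto intro: dvd_sum)
next
  case (Suc a)
  define \<rho> where "\<rho> = \<sigma> ^^ (2 ^ a)"
  have iter: "(\<sigma> ^^ k) x \<in> S \<and> w ((\<sigma> ^^ k) x) = w x" if "x \<in> S" for k x
    using that Suc.prems(2) by (induction k) auto
  have \<rho>: "\<rho> (\<rho> x) = x" "\<rho> x \<in> S" "w (\<rho> x) = w x" if "x \<in> S" for x
  proof -
    have "(2::nat) ^ Suc a = 2 ^ a + 2 ^ a" by simp
    then have "\<rho> (\<rho> x) = (\<sigma> ^^ (2 ^ Suc a)) x" by (metis \<rho>_def comp_apply funpow_add)
    then show "\<rho> (\<rho> x) = x" using Suc.prems(3) that by simp
  qed (use iter that in \<open>auto simp: \<rho>_def\<close>)
  define S1 where "S1 = {x \<in> S. \<rho> x = x}"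
  define S2 where "S2 = {x \<in> S. \<rho> x \<noteq> x}"
  have "even (sum w S1)"
  proof (rule Suc.IH)
    show "\<sigma> x \<in> S1 \<and> w (\<sigma> x) = w x" if "x \<in> S1" for x
      using that Suc.prems(2)[of x] funpow_swap1[of \<sigma> "2 ^ a" x] by (auto simp: S1_def \<rho>_def)
  qed (use Suc.prems in \<open>auto simp: S1_def \<rho>_def\<close>)
  moreover have "even (sum w S2)"
  proof (rule even_sum_fixpoint_free_involution)
    show "finite S2" using Suc.prems(1) by (simp add: S2_def)
    show "\<rho> x \<in> S2 \<and> \<rho> (\<rho> x) = x \<and> \<rho> x \<noteq> x \<and> w (\<rho> x) = w x" if "x \<in> S2" for x
      using that \<rho>[of x] by (auto simp: S2_def)
  qed
  moreover have "sum w S = sum w S1 + sum w S2"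
    using Suc.prems(1) by (subst sum.union_disjoint[symmetric]) (auto simp: S1_def S2_def intro: sum.cong)
  ultimately show ?case by simp
qed

text \<open>A product of m disjoint transpositions has the parity of m. Hence sets of size divisible
  by 4 admit an even involution without fixed points.\<close>

lemma ex_fixpoint_free_involution:
  assumes "finite P" "card P = 2 * m"
  shows "\<exists>\<tau>. \<tau> permutes P \<and> \<tau> \<circ> \<tau> = id \<and> (\<forall>x\<in>P. \<tau> x \<noteq> x) \<and> (evenperm \<tau> \<longleftrightarrow> even m)"
  using assms
proof (induction m arbitrary: P)
  case 0
  then show ?case by (intro exI[of _ id]) auto
next
  case (Suc m)
  then obtain a where a: "a \<in> P" by fastforce
  have "card (P - {a}) \<noteq> 0" using Suc.prems a by simp
  then have "P - {a} \<noteq> {}" by (metis card.empty)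
  then obtain b where b: "b \<in> P" "b \<noteq> a" by blast
  have "card (P - {a, b}) = 2 * m" using Suc.prems a b by simp
  then obtain \<tau> where \<tau>: "\<tau> permutes (P - {a, b})" "\<tau> \<circ> \<tau> = id" "\<forall>x\<in>P - {a, b}. \<tau> x \<noteq> x"
    "evenperm \<tau> \<longleftrightarrow> even m"
    using Suc.IH[of "P - {a, b}"] Suc.prems(1) finite_Diff by blast
  have \<tau>\<tau>: "\<tau> (\<tau> x) = x" for x using \<tau>(2) by (metis comp_apply id_apply)
  have \<tau>ab: "\<tau> a = a" "\<tau> b = b" using \<tau>(1) by (auto simp: permutes_not_in)
  have \<tau>_ne: "\<tau> x \<noteq> a" "\<tau> x \<noteq> b" if "x \<noteq> a" "x \<noteq> b" for x
    using that \<tau>\<tau> \<tau>ab by metis+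
  let ?t = "transpose a b \<circ> \<tau>"
  have "?t permutes P"
    using \<tau>(1) a b by (intro permutes_compose[OF permutes_subset[OF \<tau>(1)]] permutes_swap_id) auto
  moreover have "?t \<circ> ?t = id"
  proof
    fix x show "(?t \<circ> ?t) x = id x"
      using \<tau>ab \<tau>\<tau> \<tau>_ne[of x] by (cases "x = a"; cases "x = b") auto
  qed
  moreover have "?t x \<noteq> x" if "x \<in> P" for x
    using that \<tau>ab \<tau>_ne[of x] \<tau>(3) b by (cases "x = a"; cases "x = b") auto
  moreover have "permutation \<tau>"
    using \<tau>(1) Suc.prems permutation_permutes finite_Diff by blast
  then have "evenperm ?t \<longleftrightarrow> even (Suc m)"
    using \<tau>(4) b by (simp add: evenperm_comp permutation_swap_id evenperm_swap)
  ultimately show ?case by blast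
qed

section \<open>Symmetric circuits\<close>

lemma act_edge_comp: "bij \<pi> \<Longrightarrow> bij \<pi>' \<Longrightarrow> act_edge (\<pi> \<circ> \<pi>') e = act_edge \<pi> (act_edge \<pi>' e)"
  by (simp add: act_edge_def act_vert_def o_inv_distrib image_image comp_assoc)

lemma act_edge_id: "act_edge id e = e"
  by (simp add: act_edge_def act_vert_def)

section \<open>Extensions of permutations, stabilisers of gates and their index\<close>

locale symmetric_circuit =
  fixes n :: nat and C :: "'g circuit"
  assumes circuit: "xor_circuit n C"
    and symmetric: "\<pi> permutes {1..n} \<Longrightarrow> \<exists>\<sigma>. extends_to C \<pi> \<sigma>"
begin

lemma finite_gates: "finite (gates C)"
  and wires_subset: "wires C \<subseteq> gates C \<times> gates C"
  and acyclic_wires: "acyclic (wires C)"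
  and root_gate: "circuit_root C \<in> gates C"
  using circuit unfolding xor_circuit_def by simp_all

lemma automorphism_permutes: "rooted_dag_automorphism C \<sigma> \<Longrightarrow> \<sigma> permutes gates C"
  by (simp add: rooted_dag_automorphism_def)

lemma automorphism_wires:
  assumes "rooted_dag_automorphism C \<sigma>"
  shows "(\<sigma> g, \<sigma> h) \<in> wires C \<longleftrightarrow> (g, h) \<in> wires C"
proof -
  have "\<sigma> x \<in> gates C \<longleftrightarrow> x \<in> gates C" for x
    using assms by (simp add: automorphism_permutes permutes_in_image)
  then show ?thesis
    using assms wires_subset unfolding rooted_dag_automorphism_def by (metis mem_Sigma_iff subsetD)
qed

lemma automorphism_inv:
  assumes "rooted_dag_automorphism C \<sigma>"
  shows "rooted_dag_automorphism C (inv \<sigma>)"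
proof -
  have perm: "\<sigma> permutes gates C" using assms by (rule automorphism_permutes)
  have "(inv \<sigma> g, inv \<sigma> h) \<in> wires C \<longleftrightarrow> (g, h) \<in> wires C" for g h
    using automorphism_wires[OF assms, of "inv \<sigma> g" "inv \<sigma> h"] perm by (simp add: permutes_inverses)
  moreover have "inv \<sigma> (circuit_root C) = circuit_root C"
    using assms perm by (simp add: permutes_inv_eq rooted_dag_automorphism_def)
  ultimately show ?thesis
    using perm by (auto simp: rooted_dag_automorphism_def permutes_inv)
qed

lemma automorphism_input_gates:
  assumes "rooted_dag_automorphism C \<sigma>" "g \<in> input_gates C"
  shows "\<sigma> g \<in> input_gates C"
proof -
  have perm: "\<sigma> permutes gates C" using assms automorphism_permutes by blast
  have "(\<sigma> g, h) \<notin> wires C" for h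
    using automorphism_wires[OF assms(1), of g "inv \<sigma> h"] assms(2) perm
    by (simp add: permutes_inverses input_gates_def)
  then show ?thesis
    using assms(2) perm by (simp add: input_gates_def permutes_in_image)
qed

lemma extends_to_id: "extends_to C id id"
  by (simp add: extends_to_def rooted_dag_automorphism_def act_edge_id)

lemma extends_to_comp:
  assumes "extends_to C \<pi> \<sigma>" "extends_to C \<pi>' \<sigma>'" "bij \<pi>" "bij \<pi>'"
  shows "extends_to C (\<pi> \<circ> \<pi>') (\<sigma> \<circ> \<sigma>')"
proof -
  have aut: "rooted_dag_automorphism C \<sigma>" "rooted_dag_automorphism C \<sigma>'"
    using assms by (auto simp: extends_to_def)
  then have "rooted_dag_automorphism C (\<sigma> \<circ> \<sigma>')"
    using automorphism_wires[OF aut(1)] automorphism_wires[OF aut(2)]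
    by (simp add: rooted_dag_automorphism_def permutes_compose)
  then show ?thesis
    using assms automorphism_input_gates[OF aut(2)] by (simp add: extends_to_def act_edge_comp)
qed

lemma extends_to_inv:
  assumes "extends_to C \<pi> \<sigma>" "bij \<pi>"
  shows "extends_to C (inv \<pi>) (inv \<sigma>)"
proof -
  have aut: "rooted_dag_automorphism C \<sigma>" using assms by (auto simp: extends_to_def)
  have "input_label C (inv \<sigma> g) = act_edge (inv \<pi>) (input_label C g)" if "g \<in> input_gates C" for g
  proof -
    have "inv \<sigma> g \<in> input_gates C"
      using that automorphism_inv[OF aut] automorphism_input_gates by blast
    then have "input_label C (\<sigma> (inv \<sigma> g)) = act_edge \<pi> (input_label C (inv \<sigma> g))"
      using assms by (auto simp: extends_to_def)
    then have "act_edge (inv \<pi>) (input_label C g) = act_edge (inv \<pi> \<circ> \<pi>) (input_label C (inv \<sigma> g))"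
      using assms(2) aut automorphism_permutes[OF aut]
      by (simp add: act_edge_comp bij_imp_bij_inv permutes_inverses)
    then show ?thesis using assms(2) by (simp add: bij_is_inj act_edge_id)
  qed
  then show ?thesis using automorphism_inv[OF aut] by (simp add: extends_to_def)
qed

lemma extends_to_funpow:
  assumes "extends_to C \<pi> \<sigma>" "bij \<pi>"
  shows "extends_to C (\<pi> ^^ k) (\<sigma> ^^ k)"
proof (induction k)
  case 0 show ?case using extends_to_id by (simp add: id_def)
next
  case (Suc k)
  then show ?case using assms by (auto intro!: extends_to_comp bij_betw_funpow simp del: o_apply)
qed

lemma Stab_iff: "\<pi> \<in> Stab n C g \<longleftrightarrow> \<pi> permutes {1..n} \<and> (\<exists>\<sigma>. extends_to C \<pi> \<sigma> \<and> \<sigma> g = g)"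
  by (auto simp: Stab_def Aut_def)

lemma perm_group_Stab: "perm_group {1..n} (Stab n C g)"
proof
  fix \<pi> assume \<pi>: "\<pi> \<in> Stab n C g"
  then obtain \<sigma> where \<sigma>: "extends_to C \<pi> \<sigma>" "\<sigma> g = g" "\<pi> permutes {1..n}"
    by (auto simp: Stab_iff)
  then have "\<sigma> permutes gates C" by (simp add: extends_to_def rooted_dag_automorphism_def)
  then have "inv \<sigma> g = g" using \<sigma> by (simp add: permutes_inv_eq)
  then show "inv \<pi> \<in> Stab n C g"
    using \<sigma> extends_to_inv[OF \<sigma>(1) permutes_bij[OF \<sigma>(3)]] unfolding Stab_iff
    by (blast intro: permutes_inv)
  fix \<pi>' assume "\<pi>' \<in> Stab n C g"
  then obtain \<sigma>' where \<sigma>': "extends_to C \<pi>' \<sigma>'" "\<sigma>' g = g" "\<pi>' permutes {1..n}"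
    by (auto simp: Stab_iff)
  then have "extends_to C (\<pi> \<circ> \<pi>') (\<sigma> \<circ> \<sigma>')" "(\<sigma> \<circ> \<sigma>') g = g"
    using \<sigma> by (auto intro: extends_to_comp permutes_bij)
  then show "\<pi> \<circ> \<pi>' \<in> Stab n C g"
    using \<sigma> \<sigma>' by (auto simp: Stab_iff permutes_compose)
next
  show "id \<in> Stab n C g" using extends_to_id by (auto simp: Stab_iff)
qed (auto simp: Stab_iff)

lemma Stab_root: "\<pi> permutes {1..n} \<Longrightarrow> \<pi> \<in> Stab n C (circuit_root C)"
proof -
  assume \<pi>: "\<pi> permutes {1..n}"
  then obtain \<sigma> where \<sigma>: "extends_to C \<pi> \<sigma>" using symmetric by blast
  then have "\<sigma> (circuit_root C) = circuit_root C"
    by (simp add: extends_to_def rooted_dag_automorphism_def)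
  then show ?thesis using \<pi> \<sigma> Stab_iff by blast
qed

text \<open>The index bound in terms of orbits: a permutation is coloured by the image of h under an
  extension that fixes g, so the orbit bounds the number of colours. The roles of g and h are free,
  which allows use in both directions along a wire.\<close>

lemma alt_subset_Stab_neighbour:
  assumes alt: "alt Q \<subseteq> Stab n C g" and Q: "Q \<subseteq> {1..n}" "4 \<le> card Q" and h: "h \<in> gates C"
    and orbit: "40 * card (Orbit n C g h) < (card Q)\<^sup>2"
  shows "\<exists>x\<in>Q. alt (Q - {x}) \<subseteq> Stab n C h"
proof -
  interpret perm_group "{1..n}" "Stab n C h" by (rule perm_group_Stab)
  have "\<exists>\<sigma>. \<pi> permutes {1..n} \<and> extends_to C \<pi> \<sigma> \<and> \<sigma> g = g" if "\<pi> \<in> alt Q" for \<pi>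
    using that alt by (auto simp: Stab_iff)
  \<comment> \<open>Extensions need not be unique, and any choice will do: if two chosen extensions
    agree at h, the quotient of the extensions fixes h and extends the quotient of the
    permutations.\<close>
  then obtain lift where lift:
    "\<And>\<pi>. \<pi> \<in> alt Q \<Longrightarrow> \<pi> permutes {1..n} \<and> extends_to C \<pi> (lift \<pi>) \<and> lift \<pi> g = g"
    by metis
  define col where "col = (\<lambda>\<pi>. lift \<pi> h)"
  have "Orbit n C g h \<subseteq> gates C"
    using h by (auto simp: Orbit_def Aut_def extends_to_def rooted_dag_automorphism_def permutes_in_image)
  then have "finite (Orbit n C g h)" using finite_gates finite_subset by blast
  moreover have "col ` alt Q \<subseteq> Orbit n C g h"
    using lift unfolding Orbit_def Aut_def col_def by blast
  ultimately have "card (col ` alt Q) \<le> card (Orbit n C g h)" by (rule card_mono)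
  then have "40 * card (col ` alt Q) < (card Q)\<^sup>2" using orbit by linarith
  moreover have "inv \<pi> \<circ> \<rho> \<in> Stab n C h"
    if "\<pi> \<in> alt Q" "\<rho> \<in> alt Q" "col \<pi> = col \<rho>" for \<pi> \<rho>
  proof -
    note l = lift[OF that(1)] lift[OF that(2)]
    have "extends_to C (inv \<pi> \<circ> \<rho>) (inv (lift \<pi>) \<circ> lift \<rho>)"
      using l by (intro extends_to_comp extends_to_inv) (auto intro: permutes_bij permutes_inv)
    moreover have "lift \<pi> permutes gates C"
      using l by (simp add: extends_to_def rooted_dag_automorphism_def)
    then have "(inv (lift \<pi>) \<circ> lift \<rho>) h = h"
      using that(3) by (simp add: col_def permutes_inv_eq)
    ultimately show ?thesis
      using l by (auto simp: Stab_iff permutes_compose permutes_inv)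
  qed
  moreover have "finite Q" using Q(1) finite_subset by blast
  ultimately show ?thesis
    using alt_point_stabiliser_subset[of Q col] Q(2) by blast
qed

section \<open>Paths from the root and their parity\<close>

abbreviation "rt \<equiv> circuit_root C"
abbreviation "num_paths g \<equiv> card (directed_paths C rt g)"

lemma directed_paths_step:
  assumes "g \<noteq> rt" "g \<in> gates C"
  shows "directed_paths C rt g = (\<Union>h\<in>{h. (h, g) \<in> wires C}. (\<lambda>p. p @ [g]) ` directed_paths C rt h)"
    (is "_ = ?R")
proof
  show "?R \<subseteq> directed_paths C rt g"
    using assms by (auto simp: directed_paths_def successively_append_iff)
  show "directed_paths C rt g \<subseteq> ?R"
  proof
    fix p assume p: "p \<in> directed_paths C rt g"
    define q where "q = butlast p"
    have pq: "p = q @ [g]"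
      using p append_butlast_last_id[of p] by (simp add: directed_paths_def q_def)
    moreover have "q \<noteq> []" using p pq assms by (auto simp: directed_paths_def)
    ultimately have "q \<in> directed_paths C rt (last q)" "(last q, g) \<in> wires C"
      using p by (auto simp: directed_paths_def successively_append_iff)
    then show "p \<in> ?R" using pq by auto
  qed
qed

lemma directed_paths_root: "directed_paths C rt rt = {[rt]}"
proof
  show "{[rt]} \<subseteq> directed_paths C rt rt"
    using root_gate by (auto simp: directed_paths_def)
  have "(hd p, last p) \<in> (wires C)\<^sup>*" if "p \<noteq> []" "successively (\<lambda>x y. (x, y) \<in> wires C) p" for p
    using that
  proof (induction p)
    case (Cons x p)
    then show ?case
      by (cases "p = []") (auto simp: successively_Cons intro: converse_rtrancl_into_rtrancl)
  qed simp
  note reach = this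
  show "directed_paths C rt rt \<subseteq> {[rt]}"
  proof
    fix p assume p: "p \<in> directed_paths C rt rt"
    then obtain q where q: "p = rt # q" by (cases p) (auto simp: directed_paths_def)
    have "q = []"
    proof (rule ccontr)
      assume "q \<noteq> []"
      then have "(rt, hd q) \<in> wires C" "(hd q, rt) \<in> (wires C)\<^sup>*"
        using p q reach[of q] by (auto simp: directed_paths_def successively_Cons)
      then have "(rt, rt) \<in> (wires C)\<^sup>+" by (rule rtrancl_into_trancl2)
      then show False using acyclic_wires by (simp add: acyclic_def)
    qed
    then show "p \<in> {[rt]}" using q by simp
  qed
qed

lemma finite_parents: "finite {h. (h, g) \<in> wires C}"
proof (rule finite_subset[OF _ finite_gates])
  show "{h. (h, g) \<in> wires C} \<subseteq> gates C" using wires_subset by blast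
qed

lemma wf_wires: "wf (wires C)"
proof (rule finite_acyclic_wf)
  show "finite (wires C)"
    using wires_subset finite_gates by (auto intro: finite_subset[of _ "gates C \<times> gates C"])
qed (rule acyclic_wires)

lemma finite_directed_paths: "g \<in> gates C \<Longrightarrow> finite (directed_paths C rt g)"
proof (induction g rule: wf_induct_rule[OF wf_wires])
  case (1 g)
  show ?case
  proof (cases "g = rt")
    case True then show ?thesis by (simp add: directed_paths_root)
  next
    case False
    then show ?thesis
      using 1 finite_parents wires_subset by (auto simp: directed_paths_step)
  qed
qed

lemma num_paths_step:
  assumes "g \<noteq> rt" "g \<in> gates C"
  shows "num_paths g = (\<Sum>h\<in>{h. (h, g) \<in> wires C}. num_paths h)"
proof -
  have "num_paths g = (\<Sum>h\<in>{h. (h, g) \<in> wires C}. card ((\<lambda>p. p @ [g]) ` directed_paths C rt h))"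
    unfolding directed_paths_step[OF assms]
  proof (rule card_UN_disjoint)
    show "finite {h. (h, g) \<in> wires C}" by (rule finite_parents)
    show "\<forall>h\<in>{h. (h, g) \<in> wires C}. finite ((\<lambda>p. p @ [g]) ` directed_paths C rt h)"
      using finite_directed_paths wires_subset by auto
    show "\<forall>i\<in>{h. (h, g) \<in> wires C}. \<forall>j\<in>{h. (h, g) \<in> wires C}. i \<noteq> j \<longrightarrow>
        (\<lambda>p. p @ [g]) ` directed_paths C rt i \<inter> (\<lambda>p. p @ [g]) ` directed_paths C rt j = {}"
      by (auto simp: directed_paths_def)
  qed
  moreover have "card ((\<lambda>p. p @ [g]) ` directed_paths C rt h) = num_paths h" for h
    by (rule card_image) (auto simp: inj_on_def)
  ultimately show ?thesis by simp
qed

lemma num_paths_automorphism: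
  assumes "rooted_dag_automorphism C \<sigma>"
  shows "num_paths (\<sigma> g) = num_paths g"
proof -
  have sub: "map \<sigma> ` directed_paths C rt g \<subseteq> directed_paths C rt (\<sigma> g)"
    if "rooted_dag_automorphism C \<sigma>" for \<sigma> g
  proof -
    have "\<And>x. x \<in> gates C \<Longrightarrow> \<sigma> x \<in> gates C" "\<sigma> rt = rt"
      using that by (auto simp: rooted_dag_automorphism_def permutes_in_image)
    then show ?thesis
      using automorphism_wires[OF that]
      by (auto simp: directed_paths_def successively_map hd_map last_map subset_iff)
  qed
  have perm: "\<sigma> permutes gates C" using assms by (rule automorphism_permutes)
  have "directed_paths C rt (\<sigma> g) = map \<sigma> ` map (inv \<sigma>) ` directed_paths C rt (\<sigma> g)"
    using perm by (simp add: image_comp permutes_inv_o)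
  also have "\<dots> \<subseteq> map \<sigma> ` directed_paths C rt g"
    using sub[OF automorphism_inv[OF assms], of "\<sigma> g"] perm
    by (intro image_mono) (simp add: permutes_inverses)
  finally have "directed_paths C rt (\<sigma> g) = map \<sigma> ` directed_paths C rt g"
    using sub[OF assms] by blast
  moreover have "inj_on (map \<sigma>) (directed_paths C rt g)"
    using permutes_inj[OF perm] by (meson inj_mapI inj_on_subset subset_UNIV)
  ultimately show ?thesis by (simp add: card_image)
qed

text \<open>Induction from the parents to the gate, via \<open>wf_wires\<close>. The pair
  \<open>P\<close>, \<open>Q\<close> stays the same throughout, so one orbit bound in terms of k
  serves all gates; its factor 40 is that of \<open>alt_point_stabiliser_subset\<close>.\<close>

lemma even_num_paths:
  assumes k: "4 dvd k" "8 \<le> k"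
    and orbits: "\<And>x y. (y, x) \<in> wires C \<Longrightarrow>
      40 * card (Orbit n C x y) < k\<^sup>2 \<and> 40 * card (Orbit n C y x) < k\<^sup>2"
    and P: "P \<subseteq> {1..n}" "card P = k" and Q: "Q \<subseteq> {1..n}" "card Q = k" and disj: "P \<inter> Q = {}"
    and g: "g \<in> gates C" "alt P \<subseteq> Stab n C g" "alt Q \<subseteq> Stab n C g" "\<not> alt (P \<union> Q) \<subseteq> Stab n C g"
  shows "even (num_paths g)"
  using g
proof (induction g rule: wf_induct_rule[OF wf_wires])
  case (1 g)
  interpret G: perm_group "{1..n}" "Stab n C g" by (rule perm_group_Stab)
  have fin: "finite P" "finite Q" using P(1) Q(1) finite_subset by blast+
  \<comment> \<open>The stabiliser of the root is the whole symmetric group and contains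
    \<open>alt (P \<union> Q)\<close>.\<close>
  have "g \<noteq> rt"
    using 1(5) Stab_root P(1) Q(1) permutes_subset[of _ "P \<union> Q" "{1..n}"] by (auto simp: alt_def)
  then have step: "num_paths g = (\<Sum>h\<in>{h. (h, g) \<in> wires C}. num_paths h)"
    using 1(2) by (rule num_paths_step)
  obtain m where m: "k = 2 * m" "even m" using k(1) by (auto simp: dvd_def)
  obtain \<tau>P where \<tau>P: "\<tau>P permutes P" "\<tau>P \<circ> \<tau>P = id" "\<forall>x\<in>P. \<tau>P x \<noteq> x" "evenperm \<tau>P"
    using ex_fixpoint_free_involution[of P m] fin P m by auto
  obtain \<tau>Q where \<tau>Q: "\<tau>Q permutes Q" "\<tau>Q \<circ> \<tau>Q = id" "\<forall>x\<in>Q. \<tau>Q x \<noteq> x" "evenperm \<tau>Q"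
    using ex_fixpoint_free_involution[of Q m] fin Q m by auto
  define \<tau> where "\<tau> = \<tau>P \<circ> \<tau>Q"
  have "\<tau> \<in> Stab n C g"
    using 1(3,4) \<tau>P \<tau>Q unfolding \<tau>_def by (intro G.comp_mem) (auto simp: alt_def)
  then obtain \<sigma> where \<sigma>: "extends_to C \<tau> \<sigma>" "\<sigma> g = g" and \<tau>: "\<tau> permutes {1..n}"
    by (auto simp: Stab_iff)
  have on_P: "\<tau> x = \<tau>P x" "\<tau> x \<in> P" if "x \<in> P" for x
  proof -
    have "x \<notin> Q" using that disj by blast
    then show "\<tau> x = \<tau>P x" using permutes_not_in[OF \<tau>Q(1)] by (simp add: \<tau>_def)
    then show "\<tau> x \<in> P" using that permutes_in_image[OF \<tau>P(1)] by simp
  qed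
  have on_Q: "\<tau> x = \<tau>Q x" "\<tau> x \<in> Q" if "x \<in> Q" for x
  proof -
    have *: "\<tau>Q x \<in> Q" using that permutes_in_image[OF \<tau>Q(1)] by simp
    then have "\<tau>Q x \<notin> P" using disj by blast
    then show "\<tau> x = \<tau>Q x" using permutes_not_in[OF \<tau>P(1)] by (simp add: \<tau>_def)
    then show "\<tau> x \<in> Q" using * by simp
  qed
  have \<tau>\<tau>: "\<tau> \<circ> \<tau> = id"
  proof
    fix x
    have "\<tau>P (\<tau>P y) = y" "\<tau>Q (\<tau>Q y) = y" for y
      using \<tau>P(2) \<tau>Q(2) by (metis comp_apply id_apply)+
    moreover have "\<tau> x = x" if "x \<notin> P" "x \<notin> Q"
      using that permutes_not_in[OF \<tau>P(1)] permutes_not_in[OF \<tau>Q(1)] by (simp add: \<tau>_def)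
    ultimately show "(\<tau> \<circ> \<tau>) x = id x"
      using on_P[of x] on_P[of "\<tau> x"] on_Q[of x] on_Q[of "\<tau> x"] by (cases "x \<in> P"; cases "x \<in> Q") auto
  qed
  have "permutation \<sigma>"
    using \<sigma>(1) finite_gates by (auto simp: extends_to_def rooted_dag_automorphism_def permutation_permutes)
  then obtain N where N: "\<sigma> ^^ N = id" "N > 0" by (rule permutation_is_nilpotent)
  \<comment> \<open>Raising \<sigma> to the odd part b of N makes its order a power of 2. The result
    still extends \<tau>, since an odd power of an involution is the involution itself.\<close>
  obtain a b where ab: "N = 2 ^ a * b" "odd b"
    by (rule multiplicity_decompose'[of N 2]) (use N(2) in auto)
  define \<rho> where "\<rho> = \<sigma> ^^ b"
  have "\<tau> ^^ b = \<tau>"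
  proof -
    obtain j where j: "b = Suc (2 * j)" using ab(2) by (auto elim: oddE)
    have "\<tau> ^^ 2 = id" using \<tau>\<tau> by (simp add: numeral_2_eq_2)
    then have "\<tau> ^^ (2 * j) = id" by (metis funpow_mult id_funpow)
    then show ?thesis using j by simp
  qed
  then have \<rho>: "extends_to C \<tau> \<rho>"
    using extends_to_funpow[OF \<sigma>(1) permutes_bij[OF \<tau>], of b] by (simp add: \<rho>_def)
  then have aut: "rooted_dag_automorphism C \<rho>" by (simp add: extends_to_def)
  have "(\<sigma> ^^ i) g = g" for i using \<sigma>(2) by (induction i) auto
  then have \<rho>g: "\<rho> g = g" by (simp add: \<rho>_def)
  have "even (\<Sum>h\<in>{h. (h, g) \<in> wires C}. num_paths h)"
  proof (rule even_sum_if_even_at_fixpoints)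
    show "finite {h. (h, g) \<in> wires C}" by (rule finite_parents)
    show "\<rho> h \<in> {h. (h, g) \<in> wires C} \<and> num_paths (\<rho> h) = num_paths h"
      if "h \<in> {h. (h, g) \<in> wires C}" for h
      using that automorphism_wires[OF aut, of h g] \<rho>g num_paths_automorphism[OF aut] by simp
    have "\<rho> ^^ (2 ^ a) = id"
      using N(1) ab(1) by (simp add: \<rho>_def funpow_mult mult.commute)
    then show "(\<rho> ^^ (2 ^ a)) h = h" for h by simp
  next
    fix h assume "h \<in> {h. (h, g) \<in> wires C}" and \<rho>h: "\<rho> h = h"
    then have h: "(h, g) \<in> wires C" by simp
    interpret H: perm_group "{1..n}" "Stab n C h" by (rule perm_group_Stab)
    have hg: "h \<in> gates C" using h wires_subset by blast
    \<comment> \<open>Only at a parent fixed by \<rho> does this extension witness that \<tau>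
      stabilises the parent as well.\<close>
    have \<tau>h: "\<tau> \<in> Stab n C h" using \<rho> \<rho>h \<tau> by (auto simp: Stab_iff)
    \<comment> \<open>The orbit bound loses one point x. Conjugation by \<tau> gives the alternating
      group that misses \<open>\<tau> x\<close> instead; the two sets overlap and together cover
      \<open>X\<close>.\<close>
    have full: "alt X \<subseteq> Stab n C h"
      if X: "X \<subseteq> {1..n}" "card X = k" "alt X \<subseteq> Stab n C g" and fpf: "\<And>x. x \<in> X \<Longrightarrow> \<tau> x \<in> X \<and> \<tau> x \<noteq> x"
      for X
    proof -
      have finX: "finite X" using X(1) finite_subset by blast
      obtain x where x: "x \<in> X" "alt (X - {x}) \<subseteq> Stab n C h"
        using alt_subset_Stab_neighbour[OF X(3,1) _ hg] orbits[OF h] X(2) k by auto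
      have card: "3 \<le> card (X - {x})" using x X(2) finX k by simp
      have inj: "inj \<tau>" using \<tau> permutes_inj by blast
      then have "\<tau> ` X = X" using fpf finX by (intro endo_inj_surj) (auto intro: inj_on_subset)
      then have img: "\<tau> ` (X - {x}) = X - {\<tau> x}"
        using inj by (simp add: image_set_diff)
      have "alt (\<tau> ` (X - {x})) \<subseteq> Stab n C h"
        using finX x(2) card \<tau>h by (intro H.alt_image_subset) auto
      moreover have "card (X - {\<tau> x}) = card (X - {x})"
        using x(1) fpf finX by simp
      moreover have "(X - {x}) \<inter> (X - {\<tau> x}) \<noteq> {}"
      proof
        assume "(X - {x}) \<inter> (X - {\<tau> x}) = {}"
        then have "X \<subseteq> {x, \<tau> x}" by blast
        then have "card X \<le> card {x, \<tau> x}" by (intro card_mono) auto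
        also have "\<dots> \<le> 2" by (simp add: card_insert_if)
        finally show False using X(2) k by simp
      qed
      ultimately have "alt ((X - {x}) \<union> (X - {\<tau> x})) \<subseteq> Stab n C h"
        using finX x(2) card img by (intro H.alt_Un_subset) auto
      moreover have "(X - {x}) \<union> (X - {\<tau> x}) = X" using fpf[OF x(1)] by auto
      ultimately show ?thesis by simp
    qed
    show "even (num_paths h)"
    proof (rule 1(1)[OF h hg])
      show "alt P \<subseteq> Stab n C h"
        using full[OF P 1(3)] on_P \<tau>P(3) by auto
      show "alt Q \<subseteq> Stab n C h"
        using full[OF Q 1(4)] on_Q \<tau>Q(3) by auto
      show "\<not> alt (P \<union> Q) \<subseteq> Stab n C h"
      proof
        \<comment> \<open>In this direction the lost point z lies in \<open>P\<close> or
          \<open>Q\<close>, whose alternating groups stabilise g. Both sets meet the remaining set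
          \<open>R\<close>, so gluing recovers all of \<open>P \<union> Q\<close>.\<close>
        assume PQ: "alt (P \<union> Q) \<subseteq> Stab n C h"
        have card_PQ: "card (P \<union> Q) = 2 * k"
          using fin disj P(2) Q(2) by (simp add: card_Un_disjoint)
        have "40 * card (Orbit n C h g) < (card (P \<union> Q))\<^sup>2"
          using orbits[OF h] card_PQ by (simp add: power2_eq_square)
        then obtain z where z: "z \<in> P \<union> Q" "alt (P \<union> Q - {z}) \<subseteq> Stab n C g"
          using alt_subset_Stab_neighbour[OF PQ _ _ 1(2)] P(1) Q(1) card_PQ k by auto
        define R where "R = P \<union> Q - {z}"
        have R: "finite R" "alt R \<subseteq> Stab n C g" "3 \<le> card R"
          using fin z card_PQ k by (auto simp: R_def)
        have meets: "R \<inter> X \<noteq> {}" if "X \<subseteq> P \<union> Q" "card X = k" for X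
        proof
          assume "R \<inter> X = {}"
          then have "X \<subseteq> {z}" using that by (auto simp: R_def)
          then have "card X \<le> card {z}" by (intro card_mono) auto
          then show False using that k by simp
        qed
        have "alt (R \<union> P) \<subseteq> Stab n C g"
          using R fin 1(3) P k meets[of P] by (intro G.alt_Un_subset[of R P]) auto
        then have "alt (R \<union> P \<union> Q) \<subseteq> Stab n C g"
          using R fin 1(4) Q k meets[of Q] card_mono[of "R \<union> P" R]
          by (intro G.alt_Un_subset[of "R \<union> P" Q]) auto
        moreover have "R \<union> P \<union> Q = P \<union> Q" by (auto simp: R_def)
        ultimately show False using 1(5) by simp
      qed
    qed
  qed
  then show ?case using step by simp
qed

end

section \<open>Choice of k and the conclusion for all large n\<close>

theorem theorem8p11:
  fixes C :: "nat \<Rightarrow> 'g circuit" and \<epsilon> :: real and g :: "nat \<Rightarrow> 'g"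
  assumes circuits: "\<forall>n\<ge>1. xor_circuit n (C n)"
    and poly_size: "\<exists>p :: real poly. \<forall>n\<ge>1. real (card (gates (C n))) \<le> poly p (2 ^ n)"
    and symmetric: "\<forall>n\<ge>1. \<forall>\<pi>. \<pi> permutes {1..n} \<longrightarrow> (\<exists>\<sigma>. extends_to (C n) \<pi> \<sigma>)"
    and orbits: "\<exists>f :: nat \<Rightarrow> real. f \<in> O(\<lambda>n. real n) \<and>
      (\<forall>\<^sub>F n in sequentially. \<forall>x \<in> gates (C n). \<forall>y. (y, x) \<in> wires (C n) \<longrightarrow>
         real (card (Orbit n (C n) x y)) \<le> f n \<and> real (card (Orbit n (C n) y x)) \<le> f n)"
    and eps: "\<epsilon> > 0"
    and g_gate: "\<forall>n\<ge>1. g n \<in> gates (C n)"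
    and g_parts: "\<forall>\<^sub>F n in sequentially. \<exists>P \<in> SP n (C n) (g n). \<exists>Q \<in> SP n (C n) (g n).
      P \<noteq> Q \<and> real (card P) \<ge> \<epsilon> * real n \<and> real (card Q) \<ge> \<epsilon> * real n"
  shows "\<forall>\<^sub>F n in sequentially. even (card (directed_paths (C n) (circuit_root (C n)) (g n)))"
proof -
  obtain f where f: "f \<in> O(\<lambda>n. real n)"
    and f_orbits: "\<forall>\<^sub>F n in sequentially. \<forall>x \<in> gates (C n). \<forall>y. (y, x) \<in> wires (C n) \<longrightarrow>
         real (card (Orbit n (C n) x y)) \<le> f n \<and> real (card (Orbit n (C n) y x)) \<le> f n"
    using orbits by blast
  obtain c where c: "c > 0" "\<forall>\<^sub>F n in sequentially. norm (f n) \<le> c * norm (real n)"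
    using f by (auto elim: landau_o.bigE)
  have "\<forall>\<^sub>F n in sequentially. 1 \<le> n" by (rule eventually_ge_at_top)
  \<comment> \<open>From \<epsilon> n at least 16, rounding down to a multiple of 4 leaves k at
    least 8 and at least \<epsilon> n / 2. The next threshold then gives 40 c n < (\<epsilon> n /
    2)^2, which is at most k^2.\<close>
  moreover have "\<forall>\<^sub>F n in sequentially. 16 / \<epsilon> \<le> real n"
    by (rule eventually_compose_filterlim[OF eventually_ge_at_top filterlim_real_sequentially])
  moreover have "\<forall>\<^sub>F n in sequentially. 160 * c / \<epsilon>\<^sup>2 < real n"
    by (rule eventually_compose_filterlim[OF eventually_gt_at_top filterlim_real_sequentially])
  ultimately show ?thesis
    using c(2) f_orbits g_parts
  proof eventually_elim
    case (elim n)
    interpret symmetric_circuit n "C n"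
      using circuits symmetric elim(1) by unfold_locales auto
    interpret G: perm_group "{1..n}" "Stab n (C n) (g n)" by (rule perm_group_Stab)
    have eps_n: "16 \<le> \<epsilon> * n" "160 * c < \<epsilon>\<^sup>2 * n"
      using elim(2,3) eps by (simp_all add: field_simps)
    \<comment> \<open>The largest multiple of 4 not exceeding \<epsilon> n.\<close>
    define k where "k = 4 * nat \<lfloor>\<epsilon> * n / 4\<rfloor>"
    have k_real: "real k = 4 * of_int \<lfloor>\<epsilon> * n / 4\<rfloor>"
      using eps_n(1) by (simp add: k_def)
    have k: "real k \<le> \<epsilon> * n" "\<epsilon> * n - 4 \<le> real k"
      unfolding k_real by linarith+
    then have "\<epsilon> * n / 2 \<le> real k" using eps_n(1) by linarith
    then have "(\<epsilon> * n / 2)\<^sup>2 \<le> (real k)\<^sup>2"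
      using eps by (intro power_mono) auto
    moreover have "160 * c * n < \<epsilon>\<^sup>2 * n * n"
      using eps_n(2) elim(1) by (intro mult_strict_right_mono) auto
    ultimately have k_sq: "40 * (c * n) < (real k)\<^sup>2"
      by (simp add: power2_eq_square field_simps)
    have small: "40 * N < k\<^sup>2" if "real N \<le> f n" for N :: nat
    proof -
      have "real (40 * N) < real (k\<^sup>2)" using that elim(4) k_sq by simp
      then show ?thesis by (simp only: of_nat_less_iff)
    qed
    obtain P' Q' where PQ': "P' \<in> SP n (C n) (g n)" "Q' \<in> SP n (C n) (g n)" "P' \<noteq> Q'"
      and card': "real (card P') \<ge> \<epsilon> * n" "real (card Q') \<ge> \<epsilon> * n"
      using elim(6) by blast
    have k8: "8 \<le> k" using k(2) eps_n(1) by linarith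
    have kPQ: "k \<le> card P'" "k \<le> card Q'" using k(1) card' by linarith+
    note parts = G.distinct_parts[OF PQ'[unfolded SP_def]]
    have parts: "P' \<subseteq> {1..n}" "Q' \<subseteq> {1..n}" "P' \<inter> Q' = {}" "alt P' \<subseteq> Stab n (C n) (g n)"
      "alt Q' \<subseteq> Stab n (C n) (g n)" "\<not> alt (P' \<union> Q') \<subseteq> Stab n (C n) (g n)"
      using parts kPQ k8 by auto
    obtain P where P: "P \<subseteq> P'" "card P = k" "finite P"
      using kPQ(1) obtain_subset_with_card_n by blast
    obtain Q where Q: "Q \<subseteq> Q'" "card Q = k" "finite Q"
      using kPQ(2) obtain_subset_with_card_n by blast
    have fin': "finite P'" "finite Q'" using parts finite_subset by blast+
    \<comment> \<open>Passing to subsets of size k keeps the gate split: from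
      \<open>alt (P \<union> Q)\<close>, gluing on the parts \<open>P'\<close> and then
      \<open>Q'\<close> would give the alternating group of their union.\<close>
    have "\<not> alt (P \<union> Q) \<subseteq> Stab n (C n) (g n)"
    proof
      assume alt: "alt (P \<union> Q) \<subseteq> Stab n (C n) (g n)"
      have "P \<noteq> {}" "Q \<noteq> {}" using P Q k8 by auto
      have card3: "3 \<le> card (P \<union> Q \<union> X)" if "finite X" for X
      proof -
        have "card P \<le> card (P \<union> Q \<union> X)" using that P Q by (intro card_mono) auto
        then show ?thesis using P k8 by simp
      qed
      have "alt (P \<union> Q \<union> P') \<subseteq> Stab n (C n) (g n)"
        using alt parts(4) P Q fin' kPQ k8 card3[of "{}"] \<open>P \<noteq> {}\<close>
        by (intro G.alt_Un_subset[of "P \<union> Q" P']) auto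
      then have "alt (P \<union> Q \<union> P' \<union> Q') \<subseteq> Stab n (C n) (g n)"
        using parts(5) P Q fin' kPQ k8 card3[of P'] \<open>Q \<noteq> {}\<close>
        by (intro G.alt_Un_subset[of "P \<union> Q \<union> P'" Q']) auto
      moreover have "P \<union> Q \<union> P' \<union> Q' = P' \<union> Q'" using P Q by blast
      ultimately show False using parts(6) by simp
    qed
    moreover have "40 * card (Orbit n (C n) x y) < k\<^sup>2 \<and> 40 * card (Orbit n (C n) y x) < k\<^sup>2"
      if "(y, x) \<in> wires (C n)" for x y
      using that elim(5) wires_subset small by blast
    moreover have "4 dvd k" by (simp add: k_def)
    moreover have "alt P \<subseteq> Stab n (C n) (g n)" "alt Q \<subseteq> Stab n (C n) (g n)"
      using P Q parts alt_mono by blast+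
    moreover have "P \<subseteq> {1..n}" "Q \<subseteq> {1..n}" "P \<inter> Q = {}" using P Q parts by blast+
    ultimately show ?case
      using even_num_paths[of k P Q "g n"] k8 P Q g_gate elim(1) by blast
  qed
qed

end
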